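(* There exists a $U^\vee_q$-module structure on $V$ for which the generators $x,X,A$ of $U^\vee_q$ act on $V$ as $K^{-1}$, $B^{-1}$, $\mathbf{A}$, respectively. On this $U^\vee_q$-module $V$ the elements $z$, $Z$, $y^{-1}$ act as $$a^{-1}\mathbf{A}-a^{-2}K^{-1},\qquad a\mathbf{A}-a^{2}B^{-1},\qquad \frac{a^{-1}K^{-1}-aB^{-1}}{a^{-1}-a},$$ respectively.
   Context: $\mathbb{F}$ is a field and $q\in\mathbb{F}$ is nonzero with $q^4\neq 1$. Tridiagonal pairs. Let $V$ be an $\mathbb{F}$-vector space of finite positive dimension. A tridiagonal pair on $V$ is an ordered pair of $\mathbb{F}$-linear maps $\mathbf{A},\mathbf{A}^*:V\to V$ such that: (i) each of $\mathbf{A},\mathbf{A}^*$ is diagonalizable; (ii) there is an ordering $\{V_i\}_{i=0}^d$ of the eigenspaces of $\mathbf{A}$ with $\mathbf{A}^*V_i\subseteq V_{i-1}+V_i+V_{i+1}$ for $0\le i\le d$ ($V_{-1}=V_{d+1}=0$); (iii) there is an ordering $\{V^*_i\}_{i=0}^\delta$ of the eigenspaces of $\mathbf{A}^*$ with $\mathbf{A}V^*_i\subseteq V^*_{i-1}+V^*_i+V^*_{i+1}$ for $0\le i\le\delta$ ($V^*_{-1}=V^*_{\delta+1}=0$); (iv) there is no subspace $W\subseteq V$ with $\mathbf{A}W\subseteq W$, $\mathbf{A}^*W\subseteq W$, $W\neq0$, $W\neq V$. It is known that $d=\delta$ (the diameter). Fix a tridiagonal pair $\mathbf{A},\mathbf{A}^*$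 on $V$ with $d\ge1$, fix orderings $\{V_i\}_{i=0}^d$, $\{V^*_i\}_{i=0}^d$ satisfying (ii), (iii), and let $\theta_i,\theta^*_i$ be the eigenvalues of $\mathbf{A},\mathbf{A}^*$ for $V_i,V^*_i$. Assume the pair has $q$-Racah type: there exist nonzero $a,b\in\mathbb{F}$ with $\theta_i=aq^{d-2i}+a^{-1}q^{2i-d}$ and $\theta^*_i=bq^{d-2i}+b^{-1}q^{2i-d}$ for $0\le i\le d$; fix these (then $a^2\neq1$). For $0\le i\le d$ let $$U_i=(V^*_0+\cdots+V^*_i)\cap(V_i+\cdots+V_d),\qquad U^\Downarrow_i=(V^*_0+\cdots+V^*_i)\cap(V_0+\cdots+V_{d-i}).$$ It is known that $V=\sum_{i=0}^dU_i$ and $V=\sum_{i=0}^dU^\Downarrow_i$ are direct sums. $K:V\to V$ (resp. $B:V\to V$) is the $\mathbb{F}$-linear map acting on $U_i$ (resp. $U^\Downarrow_i$) as $q^{d-2i}$ times the identity, for $0\le i\le d$; in particular $K,B$ are invertible. The algebra. $U_q(\mathfrak{sl}_2)$ is the $\mathbb{F}$-algebra with generators $x,y^{\pm1},z$ and relations $yy^{-1}=y^{-1}y=1$, $\frac{qxy-q^{-1}yx}{q-q^{-1}}=\frac{qyz-q^{-1}zy}{q-q^{-1}}=\frac{qzx-q^{-1}xz}{q-q^{-1}}=1$. $U^\vee_q$ is its (unital) subalgebra generated by $x,y^{-1},z$. With $a\in\mathbb{F}$ the fixed nonzero scalar satisfying $\theta_i=aq^{d-2i}+a^{-1}q^{2i-d}$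 for $0\le i\le d$, set $X=a^{-2}x+(1-a^{-2})y^{-1}$, $Z=a^2z+(1-a^2)y^{-1}$, $A=a^{-1}x+az=aX+a^{-1}Z$; these lie in $U^\vee_q$. *)

theory Defs
  imports
    "HOL-Library.Poly_Mapping"
    "HOL-Algebra.QuotRing"
    "HOL-Algebra.Generated_Rings"
begin

section \<open>Tridiagonal pairs\<close>

text \<open>
  The vector space \<open>V\<close> is the whole type \<open>'v\<close>, with scalar multiplication \<open>scale\<close>
  over the field \<open>'k\<close>.
\<close>

abbreviation vspan :: "('k::field \<Rightarrow> 'v::ab_group_add \<Rightarrow> 'v) \<Rightarrow> 'v set \<Rightarrow> 'v set" where
  "vspan scale \<equiv> Modules.module.span scale"

definition eigenspace ::
    "('k::field \<Rightarrow> 'v::ab_group_add \<Rightarrow> 'v) \<Rightarrow> ('v \<Rightarrow> 'v) \<Rightarrow> 'k \<Rightarrow> 'v set" where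
  "eigenspace scale T t = {v. T v = scale t v}"

definition eigenspaces ::
    "('k::field \<Rightarrow> 'v::ab_group_add \<Rightarrow> 'v) \<Rightarrow> ('v \<Rightarrow> 'v) \<Rightarrow> 'v set set" where
  "eigenspaces scale T = {eigenspace scale T t |t. eigenspace scale T t \<noteq> {0}}"

definition diagonalizable_map ::
    "('k::field \<Rightarrow> 'v::ab_group_add \<Rightarrow> 'v) \<Rightarrow> ('v \<Rightarrow> 'v) \<Rightarrow> bool" where
  "diagonalizable_map scale T \<longleftrightarrow> vspan scale (\<Union> (eigenspaces scale T)) = UNIV"

definition sum_subspaces ::
    "('k::field \<Rightarrow> 'v::ab_group_add \<Rightarrow> 'v) \<Rightarrow> (nat \<Rightarrow> 'v set) \<Rightarrow> nat set \<Rightarrow> 'v set" where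
  "sum_subspaces scale W I = vspan scale (\<Union>i\<in>I. W i)"

text \<open>
  \<open>W 0, \<dots>, W d\<close> lists each eigenspace of \<open>T\<close> exactly once, and \<open>T'\<close> moves each
  \<open>W i\<close> into the sum of \<open>W (i-1)\<close>, \<open>W i\<close>, \<open>W (i+1)\<close>, where the terms with index
  \<open>-1\<close> or \<open>d+1\<close> are zero.
\<close>
definition tridiagonal_ordering ::
    "('k::field \<Rightarrow> 'v::ab_group_add \<Rightarrow> 'v) \<Rightarrow> ('v \<Rightarrow> 'v) \<Rightarrow> ('v \<Rightarrow> 'v) \<Rightarrow> nat
      \<Rightarrow> (nat \<Rightarrow> 'v set) \<Rightarrow> bool" where
  "tridiagonal_ordering scale T T' d W \<longleftrightarrow>
     bij_betw W {0..d} (eigenspaces scale T) \<and>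
     (\<forall>i\<le>d. T' ` W i \<subseteq> sum_subspaces scale W {j. j \<le> d \<and> i \<le> j + 1 \<and> j \<le> i + 1})"

definition tridiagonal_pair ::
    "('k::field \<Rightarrow> 'v::ab_group_add \<Rightarrow> 'v) \<Rightarrow> ('v \<Rightarrow> 'v) \<Rightarrow> ('v \<Rightarrow> 'v) \<Rightarrow> bool" where
  "tridiagonal_pair scale T T' \<longleftrightarrow>
     (\<exists>Basis. finite_dimensional_vector_space scale Basis) \<and>
     vector_space.dim scale (UNIV :: 'v set) > 0 \<and>
     Vector_Spaces.linear scale scale T \<and> Vector_Spaces.linear scale scale T' \<and>
     diagonalizable_map scale T \<and> diagonalizable_map scale T' \<and>
     (\<exists>d W. tridiagonal_ordering scale T T' d W) \<and>
     (\<exists>\<delta> W. tridiagonal_ordering scale T' T \<delta> W) \<and>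
     \<not> (\<exists>W. Modules.module.subspace scale W \<and> T ` W \<subseteq> W \<and> T' ` W \<subseteq> W
            \<and> W \<noteq> {0} \<and> W \<noteq> UNIV)"

definition split_U ::
    "('k::field \<Rightarrow> 'v::ab_group_add \<Rightarrow> 'v) \<Rightarrow> nat \<Rightarrow> (nat \<Rightarrow> 'v set) \<Rightarrow> (nat \<Rightarrow> 'v set)
      \<Rightarrow> nat \<Rightarrow> 'v set" where
  "split_U scale d W W' i =
     sum_subspaces scale W' {0..i} \<inter> sum_subspaces scale W {i..d}"

definition split_U_down ::
    "('k::field \<Rightarrow> 'v::ab_group_add \<Rightarrow> 'v) \<Rightarrow> nat \<Rightarrow> (nat \<Rightarrow> 'v set) \<Rightarrow> (nat \<Rightarrow> 'v set)
      \<Rightarrow> nat \<Rightarrow> 'v set" where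
  "split_U_down scale d W W' i =
     sum_subspaces scale W' {0..i} \<inter> sum_subspaces scale W {0..d - i}"


section \<open>Free associative algebras\<close>

text \<open>
  The free associative unital algebra on \<open>'g\<close> over \<open>'k\<close> is the monoid algebra of the free
  monoid on \<open>'g\<close>. Convolution of finitely supported functions takes an additively written
  (here noncommutative) monoid of exponents, so concatenation of words is written \<open>+\<close>.
\<close>

datatype 'g free_word = Free_Word (letters: "'g list")

instantiation free_word :: (type) monoid_add
begin

definition "0 = Free_Word []"

definition "v + w = Free_Word (letters v @ letters w)"

instance
  by standard (simp_all add: zero_free_word_def plus_free_word_def)

end

type_synonym ('g, 'k) free_alg = "'g free_word \<Rightarrow>\<^sub>0 'k"

definition free_scalar :: "'k::field \<Rightarrow> ('g, 'k) free_alg" where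
  "free_scalar c = Poly_Mapping.single 0 c"

definition free_gen :: "'g \<Rightarrow> ('g, 'k::field) free_alg" where
  "free_gen g = Poly_Mapping.single (Free_Word [g]) 1"

definition free_alg_ring :: "('g, 'k::field) free_alg ring" where
  "free_alg_ring =
     \<lparr>carrier = UNIV, monoid.mult = (*), one = 1, ring.zero = 0, add = (+)\<rparr>"


section \<open>The equitable presentation of \<open>U\<^sub>q(sl\<^sub>2)\<close>\<close>

datatype uq_gen = Gen_x | Gen_y | Gen_yinv | Gen_z

definition q_weyl_relator :: "'k::field \<Rightarrow> uq_gen \<Rightarrow> uq_gen \<Rightarrow> (uq_gen, 'k) free_alg" where
  "q_weyl_relator q g h =
     free_scalar (1 / (q - inverse q)) *
       (free_scalar q * free_gen g * free_gen h
        - free_scalar (inverse q) * free_gen h * free_gen g) - 1"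

definition uq_relators :: "'k::field \<Rightarrow> (uq_gen, 'k) free_alg set" where
  "uq_relators q =
     {free_gen Gen_y * free_gen Gen_yinv - 1,
      free_gen Gen_yinv * free_gen Gen_y - 1,
      q_weyl_relator q Gen_x Gen_y,
      q_weyl_relator q Gen_y Gen_z,
      q_weyl_relator q Gen_z Gen_x}"

definition uq_ideal :: "'k::field \<Rightarrow> (uq_gen, 'k) free_alg set" where
  "uq_ideal q = Idl\<^bsub>free_alg_ring\<^esub> (uq_relators q)"

definition uq :: "'k::field \<Rightarrow> (uq_gen, 'k) free_alg set ring" where
  "uq q = free_alg_ring Quot uq_ideal q"

definition uq_class :: "'k::field \<Rightarrow> (uq_gen, 'k) free_alg \<Rightarrow> (uq_gen, 'k) free_alg set" where
  "uq_class q p = uq_ideal q +>\<^bsub>free_alg_ring\<^esub> p"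

definition uq_scalar :: "'k::field \<Rightarrow> 'k \<Rightarrow> (uq_gen, 'k) free_alg set" where
  "uq_scalar q c = uq_class q (free_scalar c)"

definition uq_x :: "'k::field \<Rightarrow> (uq_gen, 'k) free_alg set" where
  "uq_x q = uq_class q (free_gen Gen_x)"

definition uq_yinv :: "'k::field \<Rightarrow> (uq_gen, 'k) free_alg set" where
  "uq_yinv q = uq_class q (free_gen Gen_yinv)"

definition uq_z :: "'k::field \<Rightarrow> (uq_gen, 'k) free_alg set" where
  "uq_z q = uq_class q (free_gen Gen_z)"

text \<open>
  Adding all scalars to the generators makes the generated subring the generated
  unital \<open>'k\<close>-subalgebra.
\<close>
definition uq_vee :: "'k::field \<Rightarrow> (uq_gen, 'k) free_alg set ring" where
  "uq_vee q =
     (uq q)\<lparr>carrier :=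
        generate_ring (uq q) (range (uq_scalar q) \<union> {uq_x q, uq_yinv q, uq_z q})\<rparr>"

definition uq_X :: "'k::field \<Rightarrow> 'k \<Rightarrow> (uq_gen, 'k) free_alg set" where
  "uq_X q a =
     uq_scalar q (inverse (a^2)) \<otimes>\<^bsub>uq q\<^esub> uq_x q
       \<oplus>\<^bsub>uq q\<^esub> uq_scalar q (1 - inverse (a^2)) \<otimes>\<^bsub>uq q\<^esub> uq_yinv q"

definition uq_Z :: "'k::field \<Rightarrow> 'k \<Rightarrow> (uq_gen, 'k) free_alg set" where
  "uq_Z q a =
     uq_scalar q (a^2) \<otimes>\<^bsub>uq q\<^esub> uq_z q
       \<oplus>\<^bsub>uq q\<^esub> uq_scalar q (1 - a^2) \<otimes>\<^bsub>uq q\<^esub> uq_yinv q"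

definition uq_A :: "'k::field \<Rightarrow> 'k \<Rightarrow> (uq_gen, 'k) free_alg set" where
  "uq_A q a =
     uq_scalar q (inverse a) \<otimes>\<^bsub>uq q\<^esub> uq_x q
       \<oplus>\<^bsub>uq q\<^esub> uq_scalar q a \<otimes>\<^bsub>uq q\<^esub> uq_z q"


section \<open>Modules\<close>

text \<open>
  \<open>act\<close> is a unital left module structure, extending the given vector space structure
  \<open>scale\<close> on \<open>'v\<close>, over the algebra \<open>R\<close> whose structure map from \<open>'k\<close> is \<open>emb\<close>.
  The values of \<open>act\<close> outside \<open>carrier R\<close> are irrelevant.
\<close>
definition algebra_module_on ::
    "('k::field \<Rightarrow> 'v::ab_group_add \<Rightarrow> 'v) \<Rightarrow> 'r ring \<Rightarrow> ('k \<Rightarrow> 'r) \<Rightarrow> ('r \<Rightarrow> 'v \<Rightarrow> 'v)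
      \<Rightarrow> bool" where
  "algebra_module_on scale R emb act \<longleftrightarrow>
     (\<forall>u\<in>carrier R. Vector_Spaces.linear scale scale (act u)) \<and>
     (\<forall>v. act \<one>\<^bsub>R\<^esub> v = v) \<and>
     (\<forall>u\<in>carrier R. \<forall>w\<in>carrier R. \<forall>v. act (u \<oplus>\<^bsub>R\<^esub> w) v = act u v + act w v) \<and>
     (\<forall>u\<in>carrier R. \<forall>w\<in>carrier R. \<forall>v. act (u \<otimes>\<^bsub>R\<^esub> w) v = act u (act w v)) \<and>
     (\<forall>c. \<forall>u\<in>carrier R. \<forall>v. act (emb c \<otimes>\<^bsub>R\<^esub> u) v = scale c (act u v))"

end

(*
  Write x = K^-1, X = B^-1, Y = (a^-1 x - a X)/(a^-1 - a) and z = a^-1 A - a^-2 x. The relation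
  between z and x follows from the way A acts on the split decomposition. The remaining relations,
  those of x and z with y = Y^-1, both amount to the vanishing of E = Y x - s x Y - (1 - s) Y^2 with
  s = q^-2. Commutation of A and A* with x and X shows that A E - s^2 E A and E A* - s^2 A* E lie in
  the two-sided ideal generated by E in the algebra of x and Y. So the subspace generated by the
  image of E under x and Y is stable under A and A*. As x and X act on V / (V*_0 + ... + V*_(d-1))
  by the same scalar q^d, E maps V into V*_0 + ... + V*_(d-1), and irreducibility gives E = 0.
  Finally Y is triangular with nonzero diagonal with respect to the flag V*_0 + ... + V*_i, hence bijective,
  so V is a module over the whole of U_q(sl_2), which is restricted to the subalgebra.
*)

theory Submission
  imports Defs
begin

section \<open>Sums of subspaces and tridiagonal orderings\<close>

context vector_space
begin

lemma subspace_scale_iff: "subspace S \<Longrightarrow> c \<noteq> 0 \<Longrightarrow> scale c v \<in> S \<longleftrightarrow> v \<in> S"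
  using subspace_scale[of S "scale c v" "inverse c"] by (auto intro: subspace_scale)

lemma subspace_mem_if_diff:
  assumes "subspace S" "v \<in> S" "w - scale c v \<in> S"
  shows "w \<in> S"
  using subspace_add[OF assms(1,3) subspace_scale[OF assms(1,2), of c]] by simp

lemma subspace_sum_subspaces [simp]: "subspace (sum_subspaces scale W I)"
  by (simp add: sum_subspaces_def)

lemma sum_subspaces_mono:
  "I \<subseteq> J \<Longrightarrow> sum_subspaces scale W I \<subseteq> sum_subspaces scale W J"
  unfolding sum_subspaces_def by (intro span_mono) auto

lemma sum_subspacesI: "v \<in> W i \<Longrightarrow> i \<in> I \<Longrightarrow> v \<in> sum_subspaces scale W I"
  unfolding sum_subspaces_def by (intro span_base) auto

lemma linear_sum_subspaces:
  assumes T: "Vector_Spaces.linear scale scale T" and S: "subspace S"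
    and W: "\<And>i w. i \<in> I \<Longrightarrow> w \<in> W i \<Longrightarrow> T w \<in> S"
    and v: "v \<in> sum_subspaces scale W I"
  shows "T v \<in> S"
proof -
  interpret T: Vector_Spaces.linear scale scale T by fact
  have "subspace {v. T v \<in> S}"
    using S by (auto simp: subspace_def T.zero T.add T.scale)
  with v W show ?thesis
    unfolding sum_subspaces_def by (auto dest: span_induct[where P = "\<lambda>v. T v \<in> S"])
qed

lemma eq_on_sum_subspaces:
  assumes f: "Vector_Spaces.linear scale scale f" and g: "Vector_Spaces.linear scale scale g"
    and eq: "\<And>i w. i \<in> I \<Longrightarrow> w \<in> W i \<Longrightarrow> f w = g w"
    and v: "v \<in> sum_subspaces scale W I"
  shows "f v = g v"
proof -
  interpret f: Vector_Spaces.linear scale scale f by fact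
  interpret g: Vector_Spaces.linear scale scale g by fact
  have "Vector_Spaces.linear scale scale (\<lambda>v. f v - g v)"
    by unfold_locales (simp_all add: f.add g.add f.scale g.scale algebra_simps)
  hence "f v - g v \<in> {0}"
    using _ _ v by (rule linear_sum_subspaces) (simp_all add: eq)
  thus ?thesis
    by simp
qed

lemma sum_subspaces_subset:
  assumes "subspace S" "\<And>i. i \<in> I \<Longrightarrow> W i \<subseteq> S"
  shows "sum_subspaces scale W I \<subseteq> S"
  unfolding sum_subspaces_def using assms by (intro span_minimal) auto

lemma linear_diff_scale:
  assumes "Vector_Spaces.linear scale scale T"
  shows "Vector_Spaces.linear scale scale (\<lambda>v. T v - scale c v)"
proof -
  interpret T: Vector_Spaces.linear scale scale T by fact
  show ?thesis
    by unfold_locales (simp_all add: T.add T.scale algebra_simps)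
qed

lemma subspace_eigenspace:
  assumes "Vector_Spaces.linear scale scale T"
  shows "subspace (eigenspace scale T t)"
proof -
  interpret T: Vector_Spaces.linear scale scale T by fact
  show ?thesis
    by (auto simp: eigenspace_def subspace_def T.zero T.add T.scale scale_right_distrib mult.commute)
qed

text \<open>The map is triangular on the flag with diagonal \<open>l\<close>. Kernel vectors sink
  through the flag to \<open>F 0 = {0}\<close>, and preimages are built up from there; both
  arguments divide by \<open>l i\<close>.\<close>

lemma bij_of_flag:
  assumes T: "Vector_Spaces.linear scale scale T"
    and F: "\<And>n. subspace (F n)" "F 0 = {0}" "F (Suc d) = UNIV"
    and step: "\<And>i v. i \<le> d \<Longrightarrow> v \<in> F (Suc i) \<Longrightarrow> T v - scale (l i) v \<in> F i"
    and l: "\<And>i. i \<le> d \<Longrightarrow> l i \<noteq> 0"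
  shows "bij T"
proof -
  interpret T: Vector_Spaces.linear scale scale T by fact
  have "v \<in> F n \<Longrightarrow> T v = 0 \<Longrightarrow> v = 0" if "n \<le> Suc d" for n v
    using that
  proof (induction n)
    case 0
    thus ?case by (simp add: F)
  next
    case (Suc i)
    hence "scale (- l i) v \<in> F i"
      using step[of i v] by simp
    hence "v \<in> F i"
      using l[of i] Suc.prems subspace_scale_iff[OF F(1), of "- l i" v i] by simp
    thus ?case
      using Suc by simp
  qed
  hence "inj T"
    using F(3) by (auto simp: T.inj_iff_eq_0)
  moreover have "F n \<subseteq> range T" if "n \<le> Suc d" for n
    using that
  proof (induction n)
    case 0
    show ?case
      using T.zero by (auto simp: F intro: range_eqI[of _ _ 0])
  next
    case (Suc i)
    show ?case
    proof
      fix v assume "v \<in> F (Suc i)"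
      then obtain u where "T v - scale (l i) v = T u"
        using step[of i v] Suc by fastforce
      hence "scale (l i) v = T (v - u)"
        by (simp add: T.diff algebra_simps)
      hence "scale (inverse (l i)) (scale (l i) v) = T (scale (inverse (l i)) (v - u))"
        by (simp add: T.scale)
      thus "v \<in> range T"
        using l[of i] Suc by simp
    qed
  qed
  hence "surj T"
    using F(3) by blast
  ultimately show ?thesis
    by (simp add: bij_def)
qed

lemma linear_inv_into:
  assumes T: "Vector_Spaces.linear scale scale T" and "bij T"
  shows "Vector_Spaces.linear scale scale (inv_into UNIV T)"
proof -
  interpret T: Vector_Spaces.linear scale scale T by fact
  have surj: "T (inv_into UNIV T v) = v" and inj: "inv_into UNIV T (T v) = v" for v
    using \<open>bij T\<close> by (simp_all add: bij_is_surj surj_f_inv_f bij_is_inj)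
  show ?thesis
  proof unfold_locales
    fix v w c
    show "inv_into UNIV T (v + w) = inv_into UNIV T v + inv_into UNIV T w"
      using inj[of "inv_into UNIV T v + inv_into UNIV T w"] by (simp add: T.add surj)
    show "inv_into UNIV T (scale c v) = scale c (inv_into UNIV T v)"
      using inj[of "scale c (inv_into UNIV T v)"] by (simp add: T.scale surj)
  qed
qed

section \<open>Eigenspaces, neighbours and reversal in a tridiagonal ordering\<close>

lemma tridiagonal_ordering_eigen:
  assumes T: "Vector_Spaces.linear scale scale T"
    and eigen: "\<forall>i\<le>d. W i = eigenspace scale T (\<theta> i)"
    and I: "I \<subseteq> {0..d}" and v: "v \<in> sum_subspaces scale W I"
  shows "T v - scale (\<theta> i) v \<in> sum_subspaces scale W (I - {i})"
proof (rule linear_sum_subspaces[OF linear_diff_scale[OF T] _ _ v])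
  fix j w assume j: "j \<in> I" and w: "w \<in> W j"
  have "T w = scale (\<theta> j) w"
    using eigen I j w by (auto simp: eigenspace_def)
  moreover have "scale (\<theta> j - \<theta> i) w \<in> sum_subspaces scale W (I - {i})"
  proof (cases "j = i")
    case True
    thus ?thesis by (simp add: subspace_0)
  next
    case False
    thus ?thesis
      using j w by (intro subspace_scale sum_subspacesI) auto
  qed
  ultimately show "T w - scale (\<theta> i) w \<in> sum_subspaces scale W (I - {i})"
    by (simp add: scale_left_diff_distrib)
qed simp

lemma tridiagonal_ordering_shift:
  assumes T': "Vector_Spaces.linear scale scale T'"
    and ord: "tridiagonal_ordering scale T T' d W"
    and I: "I \<subseteq> {0..d}" and v: "v \<in> sum_subspaces scale W I"
    and J: "\<And>i j. i \<in> I \<Longrightarrow> j \<le> d \<Longrightarrow> i \<le> j + 1 \<Longrightarrow> j \<le> i + 1 \<Longrightarrow> j \<in> J"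
  shows "T' v \<in> sum_subspaces scale W J"
proof (rule linear_sum_subspaces[OF T' _ _ v])
  fix i w assume i: "i \<in> I" and w: "w \<in> W i"
  have "T' w \<in> sum_subspaces scale W {j. j \<le> d \<and> i \<le> j + 1 \<and> j \<le> i + 1}"
    using ord I i w unfolding tridiagonal_ordering_def by force
  also have "\<dots> \<subseteq> sum_subspaces scale W J"
    using J i by (intro sum_subspaces_mono) auto
  finally show "T' w \<in> sum_subspaces scale W J" .
qed simp

lemma tridiagonal_ordering_span:
  assumes "tridiagonal_ordering scale T T' d W" "diagonalizable_map scale T"
  shows "sum_subspaces scale W {0..d} = UNIV"
  using assms
  by (simp add: tridiagonal_ordering_def diagonalizable_map_def sum_subspaces_def bij_betw_def)

lemma tridiagonal_ordering_inj:
  assumes "tridiagonal_ordering scale T T' d W"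
    and "\<forall>i\<le>d. W i = eigenspace scale T (\<theta> i)"
    and "i \<le> d" "j \<le> d" "\<theta> i = \<theta> j"
  shows "i = j"
proof -
  have "inj_on W {0..d}"
    using assms(1) by (simp add: tridiagonal_ordering_def bij_betw_def)
  moreover have "W i = W j"
    using assms by simp
  ultimately show ?thesis
    using assms(3,4) by (simp add: inj_on_eq_iff)
qed

lemma tridiagonal_ordering_nonzero:
  assumes "tridiagonal_ordering scale T T' d W" "i \<le> d"
  shows "W i \<noteq> {0}"
  using assms bij_betwE[of W "{0..d}" "eigenspaces scale T"]
  unfolding tridiagonal_ordering_def eigenspaces_def by fastforce

text \<open>Reversing the eigenspaces of A turns \<open>split_U_down\<close> into
  \<open>split_U\<close>, see \<open>split_U_down_eq\<close>. One theory of the split decomposition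
  then serves both K and B.\<close>

lemma tridiagonal_ordering_rev:
  assumes "tridiagonal_ordering scale T T' d W"
  shows "tridiagonal_ordering scale T T' d (\<lambda>i. W (d - i))"
proof -
  have "bij_betw (\<lambda>i. d - i) {0..d} {0..d}"
    by (rule bij_betwI[where g = "\<lambda>i. d - i"]) auto
  from bij_betw_trans[OF this] have "bij_betw (\<lambda>i. W (d - i)) {0..d} (eigenspaces scale T)"
    using assms by (auto simp: tridiagonal_ordering_def o_def)
  moreover have "T' ` W (d - i) \<subseteq> sum_subspaces scale (\<lambda>i. W (d - i)) {j. j \<le> d \<and> i \<le> j + 1 \<and> j \<le> i + 1}"
    if "i \<le> d" for i
  proof -
    have "T' ` W (d - i) \<subseteq> sum_subspaces scale W {j. j \<le> d \<and> d - i \<le> j + 1 \<and> j \<le> d - i + 1}"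
      using assms by (simp add: tridiagonal_ordering_def)
    also have "\<dots> \<subseteq> sum_subspaces scale (\<lambda>i. W (d - i)) {j. j \<le> d \<and> i \<le> j + 1 \<and> j \<le> i + 1}"
    proof (rule sum_subspaces_subset)
      fix j assume "j \<in> {j. j \<le> d \<and> d - i \<le> j + 1 \<and> j \<le> d - i + 1}"
      hence "d - (d - j) = j" "d - j \<in> {j. j \<le> d \<and> i \<le> j + 1 \<and> j \<le> i + 1}"
        using that by auto
      thus "W j \<subseteq> sum_subspaces scale (\<lambda>i. W (d - i)) {j. j \<le> d \<and> i \<le> j + 1 \<and> j \<le> i + 1}"
        using sum_subspacesI[of _ "\<lambda>i. W (d - i)" "d - j"] by auto
    qed simp
    finally show ?thesis .
  qed
  ultimately show ?thesis
    by (simp add: tridiagonal_ordering_def)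
qed

lemma split_U_down_eq:
  assumes "i \<le> d"
  shows "split_U_down scale d W W' i = split_U scale d (\<lambda>i. W (d - i)) W' i"
proof -
  have "(\<lambda>i. d - i) ` {i..d} = {0..d - i}"
  proof (intro equalityI subsetI)
    fix j assume "j \<in> {0..d - i}"
    thus "j \<in> (\<lambda>i. d - i) ` {i..d}"
      using assms by (intro image_eqI[of _ _ "d - j"]) auto
  qed auto
  from arg_cong[OF this, of "\<lambda>S. \<Union>j\<in>S. W j"]
  have "(\<Union>j\<in>{0..d - i}. W j) = (\<Union>j\<in>{i..d}. W (d - j))"
    by simp
  thus ?thesis
    by (simp add: split_U_down_def split_U_def sum_subspaces_def)
qed

end

section \<open>The split decomposition\<close>

locale split_decomposition = vector_space scale
  for scale :: "'k::field \<Rightarrow> 'v::ab_group_add \<Rightarrow> 'v" +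
  fixes A As :: "'v \<Rightarrow> 'v" and d :: nat and V Vs :: "nat \<Rightarrow> 'v set"
    and \<theta> \<theta>s :: "nat \<Rightarrow> 'k"
  assumes pair: "tridiagonal_pair scale A As"
    and V_ord: "tridiagonal_ordering scale A As d V"
    and Vs_ord: "tridiagonal_ordering scale As A d Vs"
    and V_eigen: "\<forall>i\<le>d. V i = eigenspace scale A (\<theta> i)"
    and Vs_eigen: "\<forall>i\<le>d. Vs i = eigenspace scale As (\<theta>s i)"
begin

lemma A: "Vector_Spaces.linear scale scale A" and As: "Vector_Spaces.linear scale scale As"
  using pair by (simp_all add: tridiagonal_pair_def)

sublocale A: Vector_Spaces.linear scale scale A by (rule A)
sublocale As: Vector_Spaces.linear scale scale As by (rule As)

lemma irreducible:
  assumes "subspace W" "A ` W \<subseteq> W" "As ` W \<subseteq> W"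
  shows "W = {0} \<or> W = UNIV"
  using pair assms unfolding tridiagonal_pair_def by blast

lemma sum_V: "sum_subspaces scale V {0..d} = UNIV"
  using V_ord pair by (auto simp: tridiagonal_pair_def intro!: tridiagonal_ordering_span)

lemma sum_Vs: "sum_subspaces scale Vs {0..d} = UNIV"
  using Vs_ord pair by (auto simp: tridiagonal_pair_def intro!: tridiagonal_ordering_span)

abbreviation U :: "nat \<Rightarrow> 'v set" where
  "U \<equiv> split_U scale d V Vs"

text \<open>The half-open range makes \<open>Us 0\<close> zero and \<open>Us (Suc d)\<close> the
  whole space. The flag depends on \<open>Vs\<close> alone, so both split decompositions share
  it.\<close>

definition Us :: "nat \<Rightarrow> 'v set" where
  "Us n = sum_subspaces scale Vs {..<n}"

lemma subspace_Us [simp]: "subspace (Us n)"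
  by (simp add: Us_def)

text \<open>The range \<open>{Suc d..d}\<close> is empty. This is the convention that lets
  \<open>A_U\<close> include the case i = d.\<close>

lemma U_Suc_d: "U (Suc d) = {0}"
  by (auto simp: split_U_def sum_subspaces_def intro: span_zero)

lemma subspace_U [simp]: "subspace (U i)"
  by (simp add: split_U_def subspace_inter)

text \<open>A raises the flag of the \<open>Vs\<close> by one step, while subtracting \<theta>_i
  removes \<open>V i\<close> from the other factor of the intersection.\<close>

lemma A_U:
  assumes "i \<le> d" "v \<in> U i"
  shows "A v - scale (\<theta> i) v \<in> U (Suc i)"
proof -
  have v: "v \<in> sum_subspaces scale Vs {0..i}" "v \<in> sum_subspaces scale V {i..d}"
    using assms by (auto simp: split_U_def)
  have "A v \<in> sum_subspaces scale Vs {0..Suc i}"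
    by (rule tridiagonal_ordering_shift[OF A Vs_ord _ v(1)]) (use assms in auto)
  moreover have "v \<in> sum_subspaces scale Vs {0..Suc i}"
    using v(1) sum_subspaces_mono[of "{0..i}" "{0..Suc i}" Vs] by auto
  moreover have "A v - scale (\<theta> i) v \<in> sum_subspaces scale V ({i..d} - {i})"
    by (rule tridiagonal_ordering_eigen[OF A V_eigen _ v(2)]) auto
  moreover have "{i..d} - {i} = {Suc i..d}"
    by auto
  ultimately show ?thesis
    by (simp add: split_U_def subspace_diff subspace_scale)
qed

text \<open>Dual to \<open>A_U\<close>, with the two factors exchanging roles. The index 0 is
  treated apart because \<open>i - 1\<close> truncates.\<close>

lemma As_U:
  assumes "i \<le> d" "v \<in> U i"
  shows "As v - scale (\<theta>s i) v \<in> (if i = 0 then {0} else U (i - 1))"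
proof -
  have v: "v \<in> sum_subspaces scale Vs {0..i}" "v \<in> sum_subspaces scale V {i..d}"
    using assms by (auto simp: split_U_def)
  have *: "As v - scale (\<theta>s i) v \<in> sum_subspaces scale Vs ({0..i} - {i})"
    by (rule tridiagonal_ordering_eigen[OF As Vs_eigen _ v(1)]) (use assms in auto)
  show ?thesis
  proof (cases i)
    case 0
    thus ?thesis
      using * by (simp add: sum_subspaces_def)
  next
    case (Suc j)
    have "As v \<in> sum_subspaces scale V {j..d}"
      by (rule tridiagonal_ordering_shift[OF As V_ord _ v(2)]) (use Suc in auto)
    moreover have "v \<in> sum_subspaces scale V {j..d}"
      using v(2) Suc sum_subspaces_mono[of "{i..d}" "{j..d}" V] by auto
    moreover have "{0..i} - {i} = {0..j}"
      using Suc by auto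
    ultimately show ?thesis
      using * Suc by (simp add: split_U_def subspace_diff subspace_scale)
  qed
qed

lemma U_subset_Us: "i < n \<Longrightarrow> U i \<subseteq> Us n"
  unfolding split_U_def Us_def
  using sum_subspaces_mono[of "{0..i}" "{..<n}" Vs] by (auto simp: subset_iff)

text \<open>By \<open>A_U\<close> and \<open>As_U\<close> the sum is stable under both maps of the
  pair, so irreducibility leaves only the whole space once the sum is nonzero.\<close>

lemma sum_U: "sum_subspaces scale U {0..d} = UNIV"
proof -
  let ?W = "sum_subspaces scale U {0..d}"
  have U_W: "U i \<subseteq> ?W" if "i \<le> d" for i
    using that by (auto intro: sum_subspacesI)
  have "A v \<in> ?W" if "v \<in> ?W" for v
    using A _ _ that
  proof (rule linear_sum_subspaces)
    fix i v assume i: "i \<in> {0..d}" and v: "v \<in> U i"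
    have "U (Suc i) \<subseteq> ?W"
      using U_W U_Suc_d i by (cases "i = d") (auto simp: subspace_0)
    thus "A v \<in> ?W"
      using A_U[of i v] U_W[of i] i v
      by (intro subspace_mem_if_diff[of ?W v "A v" "\<theta> i"]) auto
  qed simp
  moreover have "As v \<in> ?W" if "v \<in> ?W" for v
    using As _ _ that
  proof (rule linear_sum_subspaces)
    fix i v assume i: "i \<in> {0..d}" and v: "v \<in> U i"
    have "(if i = 0 then {0} else U (i - 1)) \<subseteq> ?W"
      using U_W[of "i - 1"] i by (auto simp: subspace_0)
    thus "As v \<in> ?W"
      using As_U[of i v] U_W[of i] i v
      by (intro subspace_mem_if_diff[of ?W v "As v" "\<theta>s i"]) auto
  qed simp
  moreover have "?W \<noteq> {0}"
  proof -
    \<comment> \<open>For index 0 the second factor of the intersection is everything, by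
      \<open>sum_V\<close>.\<close>
    have "Vs 0 = U 0"
      using sum_V Vs_eigen subspace_eigenspace[OF As]
      by (simp add: split_U_def sum_subspaces_def span_eq_iff[THEN iffD2])
    hence "Vs 0 \<subseteq> ?W"
      using U_W by auto
    moreover have "Vs 0 \<noteq> {0}" "0 \<in> Vs 0"
      using tridiagonal_ordering_nonzero[OF Vs_ord] Vs_eigen subspace_0[OF subspace_eigenspace[OF As]]
      by auto
    ultimately show ?thesis
      by auto
  qed
  ultimately show ?thesis
    using irreducible[of ?W] by auto
qed

text \<open>Makes any operator that is scalar on each \<open>U i\<close> triangular on the flag
  \<open>Us\<close>. The inclusion from left to right uses that As is itself triangular on the
  partial sums of the \<open>U i\<close>, with distinct diagonal entries.\<close>

lemma Us_eq:
  assumes "n \<le> Suc d"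
  shows "Us n = sum_subspaces scale U {..<n}"
proof
  show "sum_subspaces scale U {..<n} \<subseteq> Us n"
    using U_subset_Us by (intro sum_subspaces_subset) auto
next
  let ?G = "\<lambda>m. sum_subspaces scale U {..<m}"
  have mono: "?G i \<subseteq> ?G j" if "i \<le> j" for i j
    using that by (intro sum_subspaces_mono) auto
  have step: "As w - scale (\<theta>s m) w \<in> ?G m" if "m \<le> d" "w \<in> ?G (Suc m)" for m w
    using linear_diff_scale[OF As] _ _ that(2)
  proof (rule linear_sum_subspaces)
    fix k u assume k: "k \<in> {..<Suc m}" and u: "u \<in> U k"
    have G: "U j \<subseteq> ?G m" if "j < m" for j
      using that by (auto intro: sum_subspacesI)
    have "(if k = 0 then {0} else U (k - 1)) \<subseteq> ?G m"
      using G[of "k - 1"] k by (auto simp: subspace_0)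
    hence *: "As u - scale (\<theta>s k) u \<in> ?G m"
      using As_U[of k u] k u that by auto
    show "As u - scale (\<theta>s m) u \<in> ?G m"
    proof (cases "k = m")
      case False
      hence "scale (\<theta>s k - \<theta>s m) u \<in> ?G m"
        using G[of k] k u by (intro subspace_scale) auto
      from subspace_add[OF _ * this] show ?thesis
        by (simp add: scale_left_diff_distrib)
    qed (use * in simp)
  qed simp
  \<comment> \<open>Descent from \<open>?G (Suc d)\<close>, the whole space: on an eigenvector in
    \<open>Vs j\<close>, subtracting the diagonal entry at level m > j only multiplies by the
    nonzero scalar \<open>\<theta>s j - \<theta>s m\<close>.\<close>
  have "Vs j \<subseteq> ?G (Suc j)" if "j \<le> d" for j
  proof
    fix v assume v: "v \<in> Vs j"
    have "Suc j \<le> Suc d"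
      using that by simp
    thus "v \<in> ?G (Suc j)"
    proof (induction rule: inc_induct)
      case base
      have "{..<Suc d} = {0..d}"
        by auto
      thus ?case
        using sum_U by simp
    next
      case (step m)
      have "As v = scale (\<theta>s j) v"
        using v Vs_eigen that by (auto simp: eigenspace_def)
      hence "scale (\<theta>s j - \<theta>s m) v \<in> ?G m"
        using \<open>\<And>m w. m \<le> d \<Longrightarrow> w \<in> ?G (Suc m) \<Longrightarrow> As w - scale (\<theta>s m) w \<in> ?G m\<close>[of m v] step
        by (simp add: scale_left_diff_distrib)
      moreover have "\<theta>s j \<noteq> \<theta>s m"
        using tridiagonal_ordering_inj[OF Vs_ord Vs_eigen, of j m] step that by auto
      ultimately show ?case
        by (simp add: subspace_scale_iff)
    qed
  qed
  moreover have "?G (Suc j) \<subseteq> ?G n" if "j < n" for j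
    using mono that by auto
  ultimately show "Us n \<subseteq> ?G n"
    unfolding Us_def using assms by (intro sum_subspaces_subset) (auto simp: subset_iff)
qed

text \<open>Otherwise an eigenvector in \<open>Vs d\<close> would sink through the flag to
  \<open>Us 0\<close>, since \<theta>s_d differs from every earlier eigenvalue.\<close>

lemma Us_proper: "Us d \<noteq> UNIV"
proof
  assume *: "Us d = UNIV"
  obtain v where v: "v \<in> Vs d" "v \<noteq> 0"
    using tridiagonal_ordering_nonzero[OF Vs_ord, of d] Vs_eigen
      subspace_0[OF subspace_eigenspace[OF As]] by auto
  have "v \<in> Us n" if "n \<le> d" for n
    using that
  proof (induction rule: inc_induct)
    case base
    thus ?case using * by simp
  next
    case (step n)
    have "As v - scale (\<theta>s n) v \<in> sum_subspaces scale Vs ({..<Suc n} - {n})"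
      using step by (intro tridiagonal_ordering_eigen[OF As Vs_eigen]) (auto simp: Us_def)
    also have "{..<Suc n} - {n} = {..<n}"
      by auto
    finally have "scale (\<theta>s d - \<theta>s n) v \<in> Us n"
      using v(1) Vs_eigen by (auto simp: Us_def eigenspace_def scale_left_diff_distrib)
    moreover have "\<theta>s d \<noteq> \<theta>s n"
      using tridiagonal_ordering_inj[OF Vs_ord Vs_eigen, of d n] step by auto
    ultimately show ?case
      by (simp add: subspace_scale_iff)
  qed
  from this[of 0] v show False
    by (simp add: Us_def sum_subspaces_def)
qed

end

section \<open>Exchange relations of an operator that is scalar on each component\<close>

text \<open>Here \<kappa>_i stands for q^(d-2i), s for q^-2, and e, f for the inverses of a, b.
  Keeping a and e as independent parameters allows them to be swapped, which is the effect on
  \<theta> of reversing the order of the eigenspaces.\<close>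

locale split_operator = split_decomposition +
  fixes s a e b f :: 'a and \<kappa> :: "nat \<Rightarrow> 'a" and K :: "'b \<Rightarrow> 'b"
  assumes s: "s \<noteq> 0"
    and \<kappa>_nonzero: "\<kappa> i \<noteq> 0"
    and \<kappa>_Suc: "\<kappa> (Suc i) = s * \<kappa> i"
    and \<theta>: "i \<le> d \<Longrightarrow> \<theta> i = a * \<kappa> i + e * inverse (\<kappa> i)"
    and \<theta>s: "i \<le> d \<Longrightarrow> \<theta>s i = b * \<kappa> i + f * inverse (\<kappa> i)"
    and K: "Vector_Spaces.linear scale scale K"
    and K_U: "i \<le> d \<Longrightarrow> v \<in> U i \<Longrightarrow> K v = scale (\<kappa> i) v"
begin

lemma bij_K: "bij K"
proof (rule bij_of_flag[OF K, of Us d \<kappa>])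
  have "{..<Suc d} = {0..d}"
    by auto
  thus "Us (Suc d) = UNIV"
    using sum_Vs by (simp add: Us_def)
  fix i v assume i: "i \<le> d" and "v \<in> Us (Suc i)"
  hence v: "v \<in> sum_subspaces scale U {..<Suc i}"
    using Us_eq[of "Suc i"] by simp
  show "K v - scale (\<kappa> i) v \<in> Us i"
    using linear_diff_scale[OF K] _ _ v
  proof (rule linear_sum_subspaces)
    fix j w assume "j \<in> {..<Suc i}" and w: "w \<in> U j"
    hence "scale (\<kappa> j - \<kappa> i) w \<in> Us i"
      using U_subset_Us[of j i] by (cases "j = i") (auto intro: subspace_scale subspace_0)
    thus "K w - scale (\<kappa> i) w \<in> Us i"
      using K_U[of j w] w i \<open>j \<in> {..<Suc i}\<close> by (simp add: scale_left_diff_distrib)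
  qed simp
qed (simp_all add: \<kappa>_nonzero Us_def sum_subspaces_def)

definition x :: "'b \<Rightarrow> 'b" where
  "x = inv_into UNIV K"

lemma x: "Vector_Spaces.linear scale scale x"
  unfolding x_def by (rule linear_inv_into[OF K bij_K])

sublocale x: Vector_Spaces.linear scale scale x by (rule x)

text \<open>Index d + 1 is included, where the component is zero, so that it applies to the raised
  part of \<open>A v\<close> for every i up to d.\<close>

lemma x_U:
  assumes "i \<le> Suc d" "v \<in> U i"
  shows "x v = scale (inverse (\<kappa> i)) v"
proof (cases "i = Suc d")
  case True
  thus ?thesis
    using assms U_Suc_d by (simp add: x.zero)
next
  case False
  have "x v = x (K (scale (inverse (\<kappa> i)) v))"
    using K_U[of i "scale (inverse (\<kappa> i)) v"] assms False by (simp add: \<kappa>_nonzero subspace_scale)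
  thus ?thesis
    using bij_K by (simp add: x_def bij_is_inj)
qed

lemma x_Us:
  assumes i: "i \<le> d" and v: "v \<in> Us (Suc i)"
  shows "x v - scale (inverse (\<kappa> i)) v \<in> Us i"
proof -
  have v: "v \<in> sum_subspaces scale U {..<Suc i}"
    using assms Us_eq[of "Suc i"] by simp
  show ?thesis
    using linear_diff_scale[OF x] _ _ v
  proof (rule linear_sum_subspaces)
    fix j w assume "j \<in> {..<Suc i}" and w: "w \<in> U j"
    hence "scale (inverse (\<kappa> j) - inverse (\<kappa> i)) w \<in> Us i"
      using U_subset_Us[of j i] by (cases "j = i") (auto intro: subspace_scale subspace_0)
    thus "x w - scale (inverse (\<kappa> i)) w \<in> Us i"
      using x_U[of j w] w i \<open>j \<in> {..<Suc i}\<close> by (simp add: scale_left_diff_distrib)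
  qed simp
qed

text \<open>On each \<open>U i\<close> the part of \<open>A v\<close> raised to the next component
  cancels, because s x acts there as x does on \<open>U i\<close>. The scalar part is the formula
  for \<theta>_i multiplied by the inverse of \<kappa>_i.\<close>

lemma A_x: "A (x v) = scale s (x (A v)) + scale (1 - s) (scale e (x (x v)) + scale a v)"
proof -
  have "v \<in> sum_subspaces scale U {0..d}"
    using sum_U by simp
  thus ?thesis
  proof (rule eq_on_sum_subspaces[rotated 3])
    show "Vector_Spaces.linear scale scale (\<lambda>v. A (x v))"
      by unfold_locales (simp_all add: A.add A.scale x.add x.scale)
    show "Vector_Spaces.linear scale scale
      (\<lambda>v. scale s (x (A v)) + scale (1 - s) (scale e (x (x v)) + scale a v))"
      by unfold_locales (simp_all add: A.add A.scale x.add x.scale algebra_simps)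
    fix i v assume i: "i \<in> {0..d}" and v: "v \<in> U i"
    define r where "r = A v - scale (\<theta> i) v"
    have "r \<in> U (Suc i)"
      unfolding r_def using A_U i v by simp
    hence xr: "scale s (x r) = scale (inverse (\<kappa> i)) r"
      using x_U[of "Suc i" r] i s by (simp add: \<kappa>_Suc)
    have xv: "x v = scale (inverse (\<kappa> i)) v"
      using x_U i v by simp
    have Av: "A v = scale (\<theta> i) v + r"
      by (simp add: r_def)
    have \<theta>_eq: "inverse (\<kappa> i) * \<theta> i = s * (\<theta> i * inverse (\<kappa> i)) + (1 - s) * (e * (inverse (\<kappa> i) * inverse (\<kappa> i)) + a)"
      using \<theta>[of i] i \<kappa>_nonzero[of i] by (simp add: field_simps)
    have "A (x v) = scale (inverse (\<kappa> i) * \<theta> i) v + scale (inverse (\<kappa> i)) r"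
      by (simp add: xv Av A.scale scale_right_distrib)
    also have "\<dots> = scale s (x (A v)) + scale (1 - s) (scale e (x (x v)) + scale a v)"
      unfolding \<theta>_eq by (simp add: xv Av x.add x.scale xr scale_right_distrib scale_left_distrib distrib_left)
    finally show "A (x v) = scale s (x (A v)) + scale (1 - s) (scale e (x (x v)) + scale a v)" .
  qed
qed

lemma x_As: "x (As v) = scale s (As (x v)) + scale (1 - s) (scale b v + scale f (x (x v)))"
proof -
  have "v \<in> sum_subspaces scale U {0..d}"
    using sum_U by simp
  thus ?thesis
  proof (rule eq_on_sum_subspaces[rotated 3])
    show "Vector_Spaces.linear scale scale (\<lambda>v. x (As v))"
      by unfold_locales (simp_all add: As.add As.scale x.add x.scale)
    show "Vector_Spaces.linear scale scale
      (\<lambda>v. scale s (As (x v)) + scale (1 - s) (scale b v + scale f (x (x v))))"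
      by unfold_locales (simp_all add: As.add As.scale x.add x.scale algebra_simps)
    fix i v assume i: "i \<in> {0..d}" and v: "v \<in> U i"
    define r where "r = As v - scale (\<theta>s i) v"
    have r: "r \<in> (if i = 0 then {0} else U (i - 1))"
      unfolding r_def using As_U i v by simp
    \<comment> \<open>The lowered part lies one component down, where \<kappa> is larger by the
      factor 1/s; for i = 0 it vanishes.\<close>
    have xr: "x r = scale (s * inverse (\<kappa> i)) r"
    proof (cases i)
      case 0
      thus ?thesis using r by (simp add: x.zero)
    next
      case (Suc j)
      thus ?thesis
        using r x_U[of j r] i s \<kappa>_Suc[of j] \<kappa>_nonzero[of j] by (simp add: field_simps)
    qed
    have xv: "x v = scale (inverse (\<kappa> i)) v"
      using x_U i v by simp
    have Asv: "As v = scale (\<theta>s i) v + r"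
      by (simp add: r_def)
    have \<theta>_eq: "\<theta>s i * inverse (\<kappa> i) = s * (inverse (\<kappa> i) * \<theta>s i) + (1 - s) * (b + f * (inverse (\<kappa> i) * inverse (\<kappa> i)))"
      using \<theta>s[of i] i \<kappa>_nonzero[of i] by (simp add: field_simps)
    have "x (As v) = scale (\<theta>s i * inverse (\<kappa> i)) v + scale (s * inverse (\<kappa> i)) r"
      by (simp add: xv Asv x.add x.scale xr)
    also have "\<dots> = scale s (As (x v)) + scale (1 - s) (scale b v + scale f (x (x v)))"
      unfolding \<theta>_eq by (simp add: xv Asv As.scale x.scale scale_right_distrib scale_left_distrib distrib_left)
    finally show "x (As v) = scale s (As (x v)) + scale (1 - s) (scale b v + scale f (x (x v)))" .
  qed
qed

end

section \<open>The relation between \<open>K\<close> and \<open>B\<close>\<close>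

text \<open>Isolates the exchange relations that the vanishing of E rests on. They are oriented to
  move A rightwards and As leftwards past x and y, so identities between words can be checked by
  normal forms.\<close>

locale split_operators = vector_space scale
  for scale :: "'k::field \<Rightarrow> 'v::ab_group_add \<Rightarrow> 'v" +
  fixes x y A As :: "'v \<Rightarrow> 'v" and s a e b f :: 'k
  assumes x: "Vector_Spaces.linear scale scale x"
    and y: "Vector_Spaces.linear scale scale y"
    and A: "Vector_Spaces.linear scale scale A"
    and As: "Vector_Spaces.linear scale scale As"
    and A_x: "A (x v) = scale s (x (A v)) + scale (1 - s) (scale e (x (x v)) + scale a v)"
    and A_y: "A (y v) = scale s (y (A v))
      + scale (1 - s) (scale e (x (y v) + y (x v)) + scale (a - e) (y (y v)))"
    and x_As: "x (As v) = scale s (As (x v)) + scale (1 - s) (scale b v + scale f (x (x v)))"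
    and y_As: "y (As v) = scale s (As (y v)) + scale (1 - s) (scale b v
      + scale f (scale (1 - e\<^sup>2) (y (y v)) + scale (e\<^sup>2) (x (y v) + y (x v) - x (x v))))"
begin

sublocale x: Vector_Spaces.linear scale scale x by (rule x)
sublocale y: Vector_Spaces.linear scale scale y by (rule y)
sublocale A: Vector_Spaces.linear scale scale A by (rule A)
sublocale As: Vector_Spaces.linear scale scale As by (rule As)

lemmas lin = x.add x.diff x.scale y.add y.diff y.scale A.add A.diff A.scale As.add As.diff As.scale

text \<open>
  In this locale \<open>y\<close> plays the role of the generator \<open>y\<^sup>-\<^sup>1\<close>, and \<open>s\<close> that of \<open>q\<^sup>-\<^sup>2\<close>. Up to a
  scalar, \<open>E = 0\<close> is the \<open>q\<close>-Weyl relation between \<open>x\<close> and the inverse of \<open>y\<close>, multiplied by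
  \<open>y\<close> on both sides.
\<close>
definition E :: "'v \<Rightarrow> 'v" where
  "E v = y (x v) - scale s (x (y v)) - scale (1 - s) (y (y v))"

text \<open>Moving A past the two factors in each word of E gives s^2. The linear terms coming from
  the constant in \<open>A_x\<close> cancel, and the remaining cubic words regroup so that each
  contains E as a factor.\<close>

lemma A_E:
  "A (E v) = scale (s\<^sup>2) (E (A v)) + scale (1 - s)
     (scale (a - e) (y (E v) + scale s (E (y v)))
      + scale e (scale (1 + s) (E (x v) + x (E v)) + scale (1 - s) (y (E v) - E (y v))))"
  unfolding E_def power2_eq_square
  by (simp add: lin A_x A_y scale_right_distrib scale_right_diff_distrib
      scale_left_distrib scale_left_diff_distrib algebra_simps)

text \<open>The counterpart of \<open>A_E\<close> with As on the other side; the terms in b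
  cancel.\<close>

lemma E_As:
  "E (As v) = scale (s\<^sup>2) (As (E v)) + scale ((1 - s) * f)
     (E (x v) + scale s (x (E v)) + y (E v) + scale s (E (y v))
      + scale (e\<^sup>2) (E (x v) + scale s (x (E v)) - scale s (y (E v)) - E (y v)))"
  unfolding E_def power2_eq_square
  by (simp add: lin x_As y_As scale_right_distrib scale_right_diff_distrib
      scale_left_distrib scale_left_diff_distrib algebra_simps power2_eq_square)

text \<open>
  The smallest subspace containing the range of \<open>E\<close> and stable under \<open>x\<close> and \<open>y\<close> is also stable
  under \<open>A\<close> and \<open>As\<close>, by \<open>A_E\<close> and \<open>E_As\<close>; irreducibility then forces it to vanish.
\<close>
lemma E_eq_0:
  assumes s: "s \<noteq> 0"
    and irreducible: "\<And>W. subspace W \<Longrightarrow> A ` W \<subseteq> W \<Longrightarrow> As ` W \<subseteq> W \<Longrightarrow> W = {0} \<or> W = UNIV"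
    and P: "subspace P" "P \<noteq> UNIV" "\<And>v. E v \<in> P"
      "\<And>v. v \<in> P \<Longrightarrow> x v \<in> P" "\<And>v. v \<in> P \<Longrightarrow> y v \<in> P"
  shows "E v = 0"
proof -
  define closed where
    "closed S \<longleftrightarrow> subspace S \<and> range E \<subseteq> S \<and> x ` S \<subseteq> S \<and> y ` S \<subseteq> S" for S
  define W where "W = \<Inter> {S. closed S}"
  have W: "closed W"
    unfolding W_def closed_def by (safe intro!: subspace_Inter) blast+
  have least: "W \<subseteq> S" if "closed S" for S
    using that by (auto simp: W_def)
  have sub: "subspace W" and EW: "\<And>v. E v \<in> W"
    and xW: "\<And>v. v \<in> W \<Longrightarrow> x v \<in> W" and yW: "\<And>v. v \<in> W \<Longrightarrow> y v \<in> W"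
    using W by (auto simp: closed_def)
  note W_intros = subspace_add[OF sub] subspace_diff[OF sub] subspace_scale[OF sub] EW xW yW
  \<comment> \<open>The relations for As give \<open>As (x v)\<close>, \<open>As (y v)\<close> and
    \<open>As (E v)\<close> only up to a power of s.\<close>
  have unscale: "v \<in> W" if "scale s v \<in> W" for v
    using subspace_scale[OF sub that, of "inverse s"] s by simp
  have AE: "A (E v) \<in> W" for v
    unfolding A_E by (intro W_intros)
  have AsE: "As (E v) \<in> W" for v
  proof -
    have "scale s (scale s (As (E v))) = E (As v) - scale ((1 - s) * f)
     (E (x v) + scale s (x (E v)) + y (E v) + scale s (E (y v))
      + scale (e\<^sup>2) (E (x v) + scale s (x (E v)) - scale s (y (E v)) - E (y v)))"
      unfolding E_As power2_eq_square by simp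
    moreover have "\<dots> \<in> W"
      by (intro W_intros)
    ultimately show ?thesis
      using unscale by auto
  qed
  \<comment> \<open>Since W is the least closed subspace, closedness of this subset already gives
    stability of W under A. The same device is used for As.\<close>
  have "closed {v \<in> W. A v \<in> W}"
    unfolding closed_def subspace_def
    by (auto simp: A.zero lin A_x A_y AE subspace_0[OF sub] intro!: W_intros)
  hence AW: "A ` W \<subseteq> W"
    using least by blast
  have "As (x v) \<in> W" if "v \<in> W" "As v \<in> W" for v
  proof (rule unscale)
    have "scale s (As (x v)) = x (As v) - scale (1 - s) (scale b v + scale f (x (x v)))"
      unfolding x_As by simp
    also have "\<dots> \<in> W"
      using that by (intro W_intros)
    finally show "scale s (As (x v)) \<in> W" .
  qed
  moreover have "As (y v) \<in> W" if "v \<in> W" "As v \<in> W" for v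
  proof (rule unscale)
    have "scale s (As (y v)) = y (As v) - scale (1 - s) (scale b v
      + scale f (scale (1 - e\<^sup>2) (y (y v)) + scale (e\<^sup>2) (x (y v) + y (x v) - x (x v))))"
      unfolding y_As by simp
    also have "\<dots> \<in> W"
      using that by (intro W_intros)
    finally show "scale s (As (y v)) \<in> W" .
  qed
  ultimately have "closed {v \<in> W. As v \<in> W}"
    unfolding closed_def subspace_def
    by (auto simp: As.zero lin AsE subspace_0[OF sub] intro!: W_intros)
  hence AsW: "As ` W \<subseteq> W"
    using least by blast
  have "W \<subseteq> P"
    by (rule least) (use P in \<open>auto simp: closed_def\<close>)
  hence "W = {0}"
    using irreducible[OF sub AW AsW] P(2) by auto
  thus ?thesis
    using EW by auto
qed

text \<open>As a e = 1, z is the solution of A = e x + a z. Subtracting e^2 x removes the quadratic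
  term of \<open>A_x\<close>.\<close>

lemma weyl_A_x:
  assumes "a * e = 1"
  defines "z \<equiv> \<lambda>v. scale e (A v) - scale (e\<^sup>2) (x v)"
  shows "z (x v) = scale s (x (z v)) + scale (1 - s) v"
  unfolding z_def power2_eq_square using assms(1)
  by (simp add: lin A_x scale_right_distrib scale_right_diff_distrib
      scale_left_distrib scale_left_diff_distrib algebra_simps)

text \<open>The two sides differ by e^2 times \<open>E v\<close>. Multiplying by the inverse of y on
  both sides yields the q-Weyl relation between that inverse and z.\<close>

lemma weyl_z_y:
  assumes ae: "a * e = 1" and E: "E v = 0"
  defines "z \<equiv> \<lambda>v. scale e (A v) - scale (e\<^sup>2) (x v)"
  shows "z (y v) = scale s (y (z v)) + scale (1 - s) (y (y v))"
proof -
  have yx: "y (x v) = scale s (x (y v)) + scale (1 - s) (y (y v))"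
    using E unfolding E_def by (simp only: diff_diff_add diff_eq_eq add_0)
  have ea: "e * ((1 - s) * (a - e)) = (1 - s) * (1 - e * e)"
    using ae by (simp add: algebra_simps)
  have "z (y v) = scale (e * s) (y (A v)) + scale (e * (1 - s) * e) (x (y v) + y (x v))
      + scale (e * ((1 - s) * (a - e))) (y (y v)) - scale (e * e) (x (y v))"
    unfolding z_def power2_eq_square
    by (simp only: A_y scale_right_distrib scale_scale mult.assoc add.assoc)
  also have "\<dots> = scale s (y (z v)) + scale (1 - s) (y (y v))"
    unfolding z_def power2_eq_square ea yx
    by (simp add: lin yx scale_right_distrib scale_right_diff_distrib
      scale_left_distrib scale_left_diff_distrib algebra_simps)
  finally show ?thesis .
qed

end

section \<open>The operators K and B together, and the action of the inverse generator\<close>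

text \<open>The second instance has the reversed eigenspaces and a, e exchanged, with the same
  \<open>Vs\<close>, \<open>\<kappa>\<close>, b and f. Its \<open>x\<close> is therefore the inverse
  of B.\<close>

locale split_operator_pair =
  K: split_operator scale A As d V Vs \<theta> \<theta>s s a e b f \<kappa> K +
  B: split_operator scale A As d "\<lambda>i. V (d - i)" Vs "\<lambda>i. \<theta> (d - i)" \<theta>s s e a b f \<kappa> B
  for scale :: "'k::field \<Rightarrow> 'v::ab_group_add \<Rightarrow> 'v" and A As d V Vs \<theta> \<theta>s s a e b f \<kappa> K B +
  assumes ae: "a * e = 1" and a_neq_e: "a \<noteq> e"
begin

abbreviation x :: "'v \<Rightarrow> 'v" where "x \<equiv> K.x"

abbreviation X :: "'v \<Rightarrow> 'v" where "X \<equiv> B.x"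

text \<open>The equation X = a^-2 x + (1 - a^-2) y^-1 solved for y^-1, with e = a^-1.\<close>

definition Y :: "'v \<Rightarrow> 'v" where
  "Y v = scale (1 / (e - a)) (scale e (x v) - scale a (X v))"

definition z :: "'v \<Rightarrow> 'v" where
  "z v = scale e (A v) - scale (e\<^sup>2) (x v)"

lemma Y: "Vector_Spaces.linear scale scale Y"
  by unfold_locales (simp_all add: Y_def K.x.add K.x.scale B.x.add B.x.scale algebra_simps)

lemma z: "Vector_Spaces.linear scale scale z"
  by unfold_locales (simp_all add: z_def K.x.add K.x.scale K.A.add K.A.scale algebra_simps)

sublocale Y: Vector_Spaces.linear scale scale Y by (rule Y)

lemma scale_Y: "scale (e - a) (Y v) = scale e (x v) - scale a (X v)"
  using a_neq_e by (simp add: Y_def)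

lemma scale_x_Y: "scale (e - a) (x (Y v)) = scale e (x (x v)) - scale a (x (X v))"
  using arg_cong[OF scale_Y[of v], of x] by (simp only: K.x.scale K.x.diff)

lemma scale_Y_Y:
  "scale (e - a) (scale (e - a) (Y (Y v))) =
     scale e (scale e (x (x v)) - scale a (X (x v))) - scale a (scale e (x (X v)) - scale a (X (X v)))"
proof -
  have "scale (e - a) (Y (Y v)) = scale e (Y (x v)) - scale a (Y (X v))"
    using arg_cong[OF scale_Y[of v], of Y] by (simp only: Y.scale Y.diff)
  hence "scale (e - a) (scale (e - a) (Y (Y v)))
    = scale e (scale (e - a) (Y (x v))) - scale a (scale (e - a) (Y (X v)))"
    by (simp only: K.scale_right_diff_distrib K.scale_left_commute)
  thus ?thesis
    by (simp only: scale_Y)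
qed

lemma A_Y:
  "A (Y v) = scale s (Y (A v))
      + scale (1 - s) (scale e (x (Y v) + Y (x v)) + scale (a - e) (Y (Y v)))" (is "?L = ?R")
proof -
  have "scale (e - a) ?L = scale e (A (x v)) - scale a (A (X v))"
    by (simp only: scale_Y flip: K.A.scale K.A.diff)
  also have "\<dots> = scale s (scale e (x (A v)) - scale a (X (A v)))
      + scale (1 - s) (scale (e * e) (x (x v)) - scale (a * a) (X (X v)))"
    unfolding K.A_x B.A_x by (simp add: algebra_simps)
  \<comment> \<open>With u = e x and w = a X this is u^2 - w^2 = u (u - w) + (u - w) u - (u - w)^2,
    where u - w = (e - a) Y.\<close>
  also have "\<dots> = scale s (scale (e - a) (Y (A v)))
      + scale (1 - s) (scale e (scale (e - a) (x (Y v)) + scale (e - a) (Y (x v)))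
          - scale (e - a) (scale (e - a) (Y (Y v))))"
    unfolding scale_x_Y scale_Y_Y unfolding scale_Y by (simp add: algebra_simps)
  also have "\<dots> = scale (e - a) ?R"
    by (simp add: algebra_simps)
  finally show ?thesis
    using a_neq_e by simp
qed

lemma Y_As:
  "Y (As v) = scale s (As (Y v)) + scale (1 - s) (scale b v
      + scale f (scale (1 - e\<^sup>2) (Y (Y v)) + scale (e\<^sup>2) (x (Y v) + Y (x v) - x (x v))))"
  (is "?L = ?R")
proof -
  have "scale (e - a) ?L = scale e (x (As v)) - scale a (X (As v))"
    by (rule scale_Y)
  also have "\<dots> = scale s (scale e (As (x v)) - scale a (As (X v)))
      + scale (1 - s) (scale (e - a) (scale b v) + scale f (scale e (x (x v)) - scale a (X (X v))))"
    unfolding K.x_As B.x_As by (simp add: algebra_simps)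
  also have "scale e (As (x v)) - scale a (As (X v)) = scale (e - a) (As (Y v))"
    by (simp only: scale_Y flip: K.As.scale K.As.diff)
  \<comment> \<open>Since a e = 1, the term a X^2 equals e (a X)^2, and a X = e x - (e - a) Y is
    then squared out.\<close>
  also have "scale e (x (x v)) - scale a (X (X v)) =
      scale (e * e) (scale (e - a) (x (Y v)) + scale (e - a) (Y (x v)) - scale (e - a) (x (x v)))
      - scale e (scale (e - a) (scale (e - a) (Y (Y v))))"
  proof -
    have coeffs: "a * (a * e) = a" "a * (e * e) = e"
      by (simp_all add: ae flip: mult.assoc)
    show ?thesis
      unfolding scale_x_Y scale_Y_Y unfolding scale_Y
      by (simp add: algebra_simps coeffs)
  qed
  also have "scale s (scale (e - a) (As (Y v))) + scale (1 - s) (scale (e - a) (scale b v) + scale f (\<dots>))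
    = scale (e - a) (scale s (As (Y v)) + scale (1 - s) (scale b v
      + scale f (scale (- e * (e - a)) (Y (Y v)) + scale (e\<^sup>2) (x (Y v) + Y (x v) - x (x v)))))"
    by (simp add: algebra_simps power2_eq_square)
  also have "- e * (e - a) = 1 - e\<^sup>2"
    using ae by (simp add: algebra_simps power2_eq_square)
  finally show ?thesis
    using a_neq_e by simp
qed

sublocale split_operators scale x Y A As s a e b f
  by unfold_locales (fact K.A_x A_Y K.x_As Y_As)+

text \<open>Both x and X have this diagonal entry on the flag, and Y combines them with coefficients
  of sum 1.\<close>

lemma Y_Us:
  assumes "i \<le> d" "v \<in> K.Us (Suc i)"
  shows "Y v - scale (inverse (\<kappa> i)) v \<in> K.Us i"
proof -
  let ?l = "inverse (\<kappa> i)"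
  have "scale (e - a) (Y v - scale ?l v) = scale e (x v - scale ?l v) - scale a (X v - scale ?l v)"
    by (simp only: K.scale_right_diff_distrib scale_Y) (simp add: algebra_simps)
  also have "\<dots> \<in> K.Us i"
    using K.subspace_Us K.x_Us[OF assms] B.x_Us[OF assms]
    by (intro K.subspace_diff[OF _ K.subspace_scale K.subspace_scale])
  finally show ?thesis
    using a_neq_e by (simp add: K.subspace_scale_iff)
qed

lemma Us_Suc_d: "K.Us (Suc d) = UNIV"
proof -
  have "{..<Suc d} = {0..d}"
    by auto
  thus ?thesis
    using K.sum_Vs by (simp add: K.Us_def)
qed

lemma bij_Y: "bij Y"
proof (rule K.bij_of_flag[OF Y, of K.Us d "\<lambda>i. inverse (\<kappa> i)"])
  show "K.Us 0 = {0}"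
    by (simp add: K.Us_def sum_subspaces_def)
qed (use Y_Us Us_Suc_d K.\<kappa>_nonzero in auto)

lemma E_zero: "E v = 0"
proof (rule E_eq_0[OF K.s K.irreducible])
  let ?P = "K.Us d"
  let ?l = "inverse (\<kappa> d)"
  show "K.subspace ?P" "?P \<noteq> UNIV"
    using K.Us_proper by simp_all
  have xP: "x w - scale ?l w \<in> ?P" and YP: "Y w - scale ?l w \<in> ?P" for w
    using K.x_Us[of d w] Y_Us[of d w] Us_Suc_d by simp_all
  show "x w \<in> ?P" "Y w \<in> ?P" if "w \<in> ?P" for w
    using xP[of w] YP[of w] that K.subspace_mem_if_diff[of ?P w] by auto
  show "E w \<in> ?P" for w
  proof -
    \<comment> \<open>Each letter is replaced by the scalar \<open>?l\<close> modulo
      \<open>?P\<close>. What is left over vanishes since the coefficients 1, -s and -(1 - s) of E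
      sum to zero.\<close>
    have "E w = (Y (x w) - scale ?l (x w)) - scale s (x (Y w) - scale ?l (Y w))
      - scale (1 - s) (Y (Y w) - scale ?l (Y w)) + scale ?l ((x w - scale ?l w)
      - scale s (Y w - scale ?l w) - scale (1 - s) (Y w - scale ?l w))"
      by (simp add: E_def algebra_simps)
    also have "\<dots> \<in> ?P"
      by (rule K.subspace_Us xP YP K.subspace_add K.subspace_scale
          | rule K.subspace_diff)+
    finally show ?thesis .
  qed
qed auto

lemma z_x: "z (x v) = scale s (x (z v)) + scale (1 - s) v"
  using weyl_A_x[OF ae] by (simp add: z_def)

text \<open>The relation E = 0 multiplied by the inverse of Y on both sides.\<close>

lemma x_inv_Y: "x (inv_into UNIV Y v) = scale s (inv_into UNIV Y (x v)) + scale (1 - s) v"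
proof -
  define w where "w = inv_into UNIV Y v"
  have v: "v = Y w" and inv: "inv_into UNIV Y (Y u) = u" for u
    using bij_Y by (simp_all add: w_def surj_f_inv_f bij_is_surj bij_is_inj)
  interpret Yi: Vector_Spaces.linear scale scale "inv_into UNIV Y"
    by (rule K.linear_inv_into[OF Y bij_Y])
  have "Y (x w) = scale s (x (Y w)) + scale (1 - s) (Y (Y w))"
    using E_zero[of w] by (simp only: E_def diff_diff_add diff_eq_eq add_0)
  from arg_cong[OF this, of "inv_into UNIV Y"] show ?thesis
    by (simp add: v inv Yi.add Yi.scale)
qed

lemma inv_Y_z: "inv_into UNIV Y (z v) = scale s (z (inv_into UNIV Y v)) + scale (1 - s) v"
proof -
  define w where "w = inv_into UNIV Y v"
  have v: "v = Y w" and inv: "inv_into UNIV Y (Y u) = u" for u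
    using bij_Y by (simp_all add: w_def surj_f_inv_f bij_is_surj bij_is_inj)
  interpret Yi: Vector_Spaces.linear scale scale "inv_into UNIV Y"
    by (rule K.linear_inv_into[OF Y bij_Y])
  have "z (Y w) = scale s (Y (z w)) + scale (1 - s) (Y (Y w))"
    using weyl_z_y[OF ae E_zero] by (simp add: z_def)
  from arg_cong[OF this, of "inv_into UNIV Y"] show ?thesis
    by (simp add: v inv Yi.add Yi.scale)
qed

end

section \<open>Modules over the algebra given by generators and relations\<close>

lemma poly_mapping_induct [case_names single add]:
  assumes single: "\<And>w c. P (Poly_Mapping.single w c)"
    and add: "\<And>p r. P p \<Longrightarrow> P r \<Longrightarrow> P (p + r)"
  shows "P (p :: 'a \<Rightarrow>\<^sub>0 'b::comm_monoid_add)"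
proof -
  have "P (\<Sum>w\<in>S. Poly_Mapping.single w (Poly_Mapping.lookup p w))" if "finite S" for S
    using that
  proof induction
    case empty
    show ?case
      \<comment> \<open>The zero function is a monomial with coefficient 0 at an arbitrary
        key.\<close>
      using single[of undefined 0] by simp
  qed (simp add: single add)
  moreover have "p = (\<Sum>w\<in>Poly_Mapping.keys p. Poly_Mapping.single w (Poly_Mapping.lookup p w))"
    by (rule poly_mapping_eqI)
      (simp add: lookup_sum lookup_single when_def sum.delta in_keys_iff)
  ultimately show ?thesis
    using finite_keys by metis
qed

text \<open>The extension of \<open>\<rho>\<close> to the free algebra. With \<open>foldr\<close>
  the rightmost letter acts first, as a left module requires.\<close>

definition free_act ::
    "('k::field \<Rightarrow> 'v::ab_group_add \<Rightarrow> 'v) \<Rightarrow> ('g \<Rightarrow> 'v \<Rightarrow> 'v) \<Rightarrow> ('g, 'k) free_alg \<Rightarrow> 'v \<Rightarrow> 'v" where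
  "free_act scale \<rho> p v =
     (\<Sum>w\<in>Poly_Mapping.keys p. scale (Poly_Mapping.lookup p w) (foldr \<rho> (letters w) v))"

context vector_space
begin

lemma free_act_single:
  "free_act scale \<rho> (Poly_Mapping.single w c) v = scale c (foldr \<rho> (letters w) v)"
  by (simp add: free_act_def)

lemma free_act_add: "free_act scale \<rho> (p + r) v = free_act scale \<rho> p v + free_act scale \<rho> r v"
proof -
  have *: "free_act scale \<rho> t v = (\<Sum>w\<in>Poly_Mapping.keys p \<union> Poly_Mapping.keys r. scale (Poly_Mapping.lookup t w) (foldr \<rho> (letters w) v))"
    if "Poly_Mapping.keys t \<subseteq> Poly_Mapping.keys p \<union> Poly_Mapping.keys r" for t
    unfolding free_act_def using that by (intro sum.mono_neutral_left) (auto simp: in_keys_iff)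
  show ?thesis
    using *[of "p + r"] *[of p] *[of r] keys_add[of p r]
    by (simp add: lookup_add scale_left_distrib sum.distrib)
qed

lemma free_act_linear:
  assumes "\<And>g. Vector_Spaces.linear scale scale (\<rho> g)"
  shows "Vector_Spaces.linear scale scale (free_act scale \<rho> p)"
proof -
  interpret g: Vector_Spaces.linear scale scale "\<rho> g" for g
    by (rule assms)
  have add: "foldr \<rho> ws (v + u) = foldr \<rho> ws v + foldr \<rho> ws u" for ws v u
    by (induction ws) (simp_all add: g.add)
  have scale: "foldr \<rho> ws (scale c v) = scale c (foldr \<rho> ws v)" for ws v c
    by (induction ws) (simp_all add: g.scale)
  show ?thesis
    by unfold_locales
      (simp_all add: free_act_def add scale scale_right_distrib sum.distrib scale_sum_right mult.commute)
qed

text \<open>By additivity in both factors it suffices to multiply monomials, where words are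
  concatenated and coefficients pass through linear maps.\<close>

lemma free_act_mult:
  assumes "\<And>g. Vector_Spaces.linear scale scale (\<rho> g)"
  shows "free_act scale \<rho> (p * r) v = free_act scale \<rho> p (free_act scale \<rho> r v)"
proof -
  note lin = free_act_linear[OF assms]
  show ?thesis
  proof (induction p rule: poly_mapping_induct)
    case (single w c)
    show ?case
    proof (induction r rule: poly_mapping_induct)
      case (single w' c')
      interpret Vector_Spaces.linear scale scale "free_act scale \<rho> (Poly_Mapping.single w c)"
        by (rule lin)
      have "scale c (foldr \<rho> (letters w) (scale c' u)) = scale c' (scale c (foldr \<rho> (letters w) u))" for u
        using scale[of c' u] by (simp only: free_act_single)
      thus ?case
        by (simp add: mult_single free_act_single plus_free_word_def mult.commute)
    next
      case (add p r)
      interpret Vector_Spaces.linear scale scale "free_act scale \<rho> (Poly_Mapping.single w c)"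
        by (rule lin)
      show ?case
        using add.IH by (simp add: free_act_add distrib_left local.add)
    qed
  qed (simp add: distrib_right free_act_add)
qed

lemma free_act_uminus: "free_act scale \<rho> (- p) v = - free_act scale \<rho> p v"
  by (simp add: free_act_def sum_negf)

lemma free_act_diff: "free_act scale \<rho> (p - r) v = free_act scale \<rho> p v - free_act scale \<rho> r v"
  using free_act_add[of \<rho> p "- r"] by (simp add: free_act_uminus)

lemma free_act_scalar: "free_act scale \<rho> (free_scalar c) v = scale c v"
  by (simp add: free_scalar_def free_act_single zero_free_word_def)

lemma free_act_one: "free_act scale \<rho> 1 v = v"
  using free_act_scalar[of \<rho> 1 v] by (simp add: free_scalar_def flip: single_one)

lemma free_act_gen: "free_act scale \<rho> (free_gen g) v = \<rho> g v"
  by (simp add: free_gen_def free_act_single)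

end

section \<open>The quotient algebra, its subalgebra and modules over them\<close>

lemma ring_free_alg_ring: "ring (free_alg_ring :: ('g, 'k::field) free_alg ring)"
proof (rule ringI)
  show "abelian_group (free_alg_ring :: ('g, 'k) free_alg ring)"
  proof (rule abelian_groupI)
    fix p :: "('g, 'k) free_alg"
    show "\<exists>r\<in>carrier free_alg_ring. r \<oplus>\<^bsub>free_alg_ring\<^esub> p = \<zero>\<^bsub>free_alg_ring\<^esub>"
      by (intro bexI[of _ "- p"]) (simp_all add: free_alg_ring_def)
  qed (simp_all add: free_alg_ring_def algebra_simps)
  show "Group.monoid (free_alg_ring :: ('g, 'k) free_alg ring)"
    by (rule monoidI) (simp_all add: free_alg_ring_def mult.assoc)
qed (simp_all add: free_alg_ring_def algebra_simps)

lemma ideal_uq_ideal: "ideal (uq_ideal q) free_alg_ring"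
  unfolding uq_ideal_def by (intro ring.genideal_ideal ring_free_alg_ring) (simp add: free_alg_ring_def)

lemma ring_uq: "ring (uq q)"
  unfolding uq_def by (rule ideal.quotient_is_ring[OF ideal_uq_ideal])

lemma carrier_uq: "carrier (uq q) = range (uq_class q)"
  by (auto simp: uq_def FactRing_def A_RCOSETS_def' uq_class_def free_alg_ring_def)

lemma uq_class_hom: "uq_class q \<in> ring_hom free_alg_ring (uq q)"
  using ideal.rcos_ring_hom[OF ideal_uq_ideal[of q]] by (simp add: uq_def uq_class_def[abs_def])

lemma uq_class_add: "uq_class q p \<oplus>\<^bsub>uq q\<^esub> uq_class q r = uq_class q (p + r)"
  using ring_hom_add[OF uq_class_hom, of p r] by (simp add: free_alg_ring_def)

lemma uq_class_mult: "uq_class q p \<otimes>\<^bsub>uq q\<^esub> uq_class q r = uq_class q (p * r)"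
  using ring_hom_mult[OF uq_class_hom, of p r] by (simp add: free_alg_ring_def)

lemma uq_class_one: "\<one>\<^bsub>uq q\<^esub> = uq_class q 1"
  using ring_hom_one[OF uq_class_hom[of q]] by (simp add: free_alg_ring_def)

lemma uq_class_eq: "uq_class q p = {h + p |h. h \<in> uq_ideal q}"
  by (auto simp: uq_class_def a_r_coset_def' free_alg_ring_def)

lemma mem_uq_class: "p \<in> uq_class q p"
proof -
  have "0 \<in> uq_ideal q"
    using additive_subgroup.zero_closed[OF ideal.axioms(1)[OF ideal_uq_ideal[of q]]]
    by (simp add: free_alg_ring_def)
  thus ?thesis
    by (force simp: uq_class_eq)
qed

lemma uq_vee_simps [simp]:
  "u \<oplus>\<^bsub>uq_vee q\<^esub> w = u \<oplus>\<^bsub>uq q\<^esub> w" "u \<otimes>\<^bsub>uq_vee q\<^esub> w = u \<otimes>\<^bsub>uq q\<^esub> w" "\<one>\<^bsub>uq_vee q\<^esub> = \<one>\<^bsub>uq q\<^esub>"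
  by (simp_all add: uq_vee_def)

lemma uq_vee_gen:
  "uq_scalar q c \<in> carrier (uq_vee q)" "uq_x q \<in> carrier (uq_vee q)"
  "uq_yinv q \<in> carrier (uq_vee q)" "uq_z q \<in> carrier (uq_vee q)"
  by (auto simp: uq_vee_def intro: generate_ring.incl)

lemma uq_vee_mult:
  "u \<in> carrier (uq_vee q) \<Longrightarrow> w \<in> carrier (uq_vee q) \<Longrightarrow> u \<otimes>\<^bsub>uq q\<^esub> w \<in> carrier (uq_vee q)"
  by (auto simp: uq_vee_def intro: generate_ring.eng_mult)

lemma carrier_uq_vee: "carrier (uq_vee q) \<subseteq> range (uq_class q)"
proof -
  let ?H = "range (uq_scalar q) \<union> {uq_x q, uq_yinv q, uq_z q}"
  have "?H \<subseteq> carrier (uq q)"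
    unfolding carrier_uq uq_scalar_def uq_x_def uq_yinv_def uq_z_def by blast
  hence "generate_ring (uq q) ?H \<subseteq> carrier (uq q)"
    using ring.generate_ring_in_carrier[OF ring_uq] by blast
  thus ?thesis
    by (simp add: uq_vee_def carrier_uq)
qed

lemma algebra_module_on_lin_comb:
  assumes "algebra_module_on scale (uq_vee q) (uq_scalar q) act"
    and "u \<in> carrier (uq_vee q)" "w \<in> carrier (uq_vee q)"
  shows "act (uq_scalar q c \<otimes>\<^bsub>uq q\<^esub> u \<oplus>\<^bsub>uq q\<^esub> uq_scalar q c' \<otimes>\<^bsub>uq q\<^esub> w) v
    = scale c (act u v) + scale c' (act w v)"
proof -
  have "uq_scalar q c \<otimes>\<^bsub>uq q\<^esub> u \<in> carrier (uq_vee q)"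
    "uq_scalar q c' \<otimes>\<^bsub>uq q\<^esub> w \<in> carrier (uq_vee q)"
    using assms(2,3) by (simp_all add: uq_vee_mult uq_vee_gen)
  thus ?thesis
    using assms by (simp add: algebra_module_on_def)
qed

context vector_space
begin

text \<open>The elements acting as zero form a two-sided ideal. It contains the relators, hence the
  ideal they generate.\<close>

lemma uq_ideal_free_act:
  assumes lin: "\<And>g. Vector_Spaces.linear scale scale (\<rho> g)"
    and rel: "\<And>p v. p \<in> uq_relators q \<Longrightarrow> free_act scale \<rho> p v = 0"
    and p: "p \<in> uq_ideal q"
  shows "free_act scale \<rho> p v = 0"
proof -
  let ?I = "{p. \<forall>v. free_act scale \<rho> p v = 0}"
  have zero: "free_act scale \<rho> r 0 = 0" for r
  proof -
    interpret Vector_Spaces.linear scale scale "free_act scale \<rho> r"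
      by (rule free_act_linear[OF lin])
    show ?thesis
      by (rule local.zero)
  qed
  have "ideal ?I free_alg_ring"
  proof (rule idealI[OF ring_free_alg_ring])
    have "free_act scale \<rho> (inv\<^bsub>add_monoid free_alg_ring\<^esub> r) v = 0" if "\<forall>v. free_act scale \<rho> r v = 0" for r v
    proof -
      interpret R: ring free_alg_ring
        by (rule ring_free_alg_ring)
      have "\<ominus>\<^bsub>free_alg_ring\<^esub> r = - r"
        by (rule R.minus_equality) (simp_all add: free_alg_ring_def)
      thus ?thesis
        using that by (simp add: a_inv_def free_act_uminus)
    qed
    thus "subgroup ?I (add_monoid free_alg_ring)"
      by unfold_locales (simp_all add: free_alg_ring_def free_act_add, simp add: free_act_def)
  qed (simp_all add: free_alg_ring_def free_act_mult[OF lin] zero)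
  moreover have "uq_relators q \<subseteq> ?I"
    using rel by auto
  ultimately have "uq_ideal q \<subseteq> ?I"
    unfolding uq_ideal_def by (rule ring.genideal_minimal[OF ring_free_alg_ring])
  thus ?thesis
    using p by auto
qed

lemma ex_uq_vee_module:
  assumes lin: "\<And>g. Vector_Spaces.linear scale scale (\<rho> g)"
    and rel: "\<And>p v. p \<in> uq_relators q \<Longrightarrow> free_act scale \<rho> p v = 0"
  obtains act where "algebra_module_on scale (uq_vee q) (uq_scalar q) act"
    and "\<And>g. act (uq_class q (free_gen g)) = \<rho> g"
proof
  \<comment> \<open>A coset acts through an arbitrary representative; by
    \<open>uq_ideal_free_act\<close> the choice does not matter.\<close>
  define act where "act C = free_act scale \<rho> (SOME p. p \<in> C)" for C
  have act: "act (uq_class q p) = free_act scale \<rho> p" for p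
  proof
    fix v
    have "(SOME r. r \<in> uq_class q p) \<in> uq_class q p"
      by (rule someI) (rule mem_uq_class)
    then obtain h where "(SOME r. r \<in> uq_class q p) = h + p" "h \<in> uq_ideal q"
      by (auto simp: uq_class_eq)
    thus "act (uq_class q p) v = free_act scale \<rho> p v"
      using uq_ideal_free_act[OF lin rel] by (simp add: act_def free_act_add)
  qed
  show "act (uq_class q (free_gen g)) = \<rho> g" for g
    by (auto simp: act free_act_gen)
  show "algebra_module_on scale (uq_vee q) (uq_scalar q) act"
    unfolding algebra_module_on_def uq_vee_simps
  proof (intro conjI ballI allI)
    fix u w v c
    assume "u \<in> carrier (uq_vee q)"
    then obtain p where u: "u = uq_class q p"
      using carrier_uq_vee by blast
    show "Vector_Spaces.linear scale scale (act u)"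
      unfolding u act by (rule free_act_linear[OF lin])
    show "act (uq_scalar q c \<otimes>\<^bsub>uq q\<^esub> u) v = scale c (act u v)"
      by (simp add: u uq_scalar_def uq_class_mult act free_act_mult[OF lin] free_act_scalar)
    assume "w \<in> carrier (uq_vee q)"
    then obtain r where w: "w = uq_class q r"
      using carrier_uq_vee by blast
    show "act (u \<oplus>\<^bsub>uq q\<^esub> w) v = act u v + act w v"
      by (simp add: u w uq_class_add act free_act_add)
    show "act (u \<otimes>\<^bsub>uq q\<^esub> w) v = act u (act w v)"
      by (simp add: u w uq_class_mult act free_act_mult[OF lin])
  qed (simp add: uq_class_one act free_act_one)
qed

end

section \<open>The module structure on \<open>V\<close>\<close>

text \<open>The hypothesis \<open>weyl\<close> is the defining relation divided by q, the shape in
  which the relations were obtained with s = q^-2.\<close>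

lemma (in vector_space) free_act_weyl:
  assumes lin: "\<And>g. Vector_Spaces.linear scale scale (\<rho> g)"
    and q: "q \<noteq> 0" "q\<^sup>2 \<noteq> 1"
    and weyl: "\<And>v. \<rho> g (\<rho> h v) = scale (inverse (q\<^sup>2)) (\<rho> h (\<rho> g v)) + scale (1 - inverse (q\<^sup>2)) v"
  shows "free_act scale \<rho> (q_weyl_relator q g h) v = 0"
proof -
  have "q * inverse (q\<^sup>2) = inverse q" "q * (1 - inverse (q\<^sup>2)) = q - inverse q"
    using q by (simp_all add: field_simps power2_eq_square)
  moreover have "q - inverse q \<noteq> 0"
    using q by (simp add: field_simps power2_eq_square)
  ultimately show ?thesis
    by (simp add: q_weyl_relator_def free_act_mult[OF lin] free_act_diff free_act_scalar
        free_act_gen free_act_one weyl scale_right_distrib)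
qed

theorem theorem12p14:
  fixes scale :: "'k::field \<Rightarrow> 'v::ab_group_add \<Rightarrow> 'v"
    and q a b :: 'k
    and \<A> \<A>s K B :: "'v \<Rightarrow> 'v"
    and d :: nat
    and V Vs :: "nat \<Rightarrow> 'v set"
    and \<theta> \<theta>s :: "nat \<Rightarrow> 'k"
  assumes q: "q \<noteq> 0" "q ^ 4 \<noteq> 1"
    and tdp: "tridiagonal_pair scale \<A> \<A>s"
    and d: "d \<ge> 1"
    and V: "tridiagonal_ordering scale \<A> \<A>s d V"
    and Vs: "tridiagonal_ordering scale \<A>s \<A> d Vs"
    and \<theta>: "\<forall>i\<le>d. V i = eigenspace scale \<A> (\<theta> i)"
    and \<theta>s: "\<forall>i\<le>d. Vs i = eigenspace scale \<A>s (\<theta>s i)"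
    and ab: "a \<noteq> 0" "b \<noteq> 0"
    and Racah: "\<forall>i\<le>d. \<theta> i = a * q powi (int d - 2 * int i)
                           + inverse a * q powi (2 * int i - int d)"
    and Racah_s: "\<forall>i\<le>d. \<theta>s i = b * q powi (int d - 2 * int i)
                           + inverse b * q powi (2 * int i - int d)"
    and K: "Vector_Spaces.linear scale scale K"
           "\<forall>i\<le>d. \<forall>v\<in>split_U scale d V Vs i. K v = scale (q powi (int d - 2 * int i)) v"
    and B: "Vector_Spaces.linear scale scale B"
           "\<forall>i\<le>d. \<forall>v\<in>split_U_down scale d V Vs i. B v = scale (q powi (int d - 2 * int i)) v"
  shows "(\<exists>act. algebra_module_on scale (uq_vee q) (uq_scalar q) act \<and>
             act (uq_x q) = inv_into UNIV K \<and>
             act (uq_X q a) = inv_into UNIV B \<and>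
             act (uq_A q a) = \<A>) \<and>
         (\<forall>act. algebra_module_on scale (uq_vee q) (uq_scalar q) act \<and>
             act (uq_x q) = inv_into UNIV K \<and>
             act (uq_X q a) = inv_into UNIV B \<and>
             act (uq_A q a) = \<A> \<longrightarrow>
             (\<forall>v. act (uq_z q) v
                    = scale (inverse a) (\<A> v) - scale (inverse (a^2)) (inv_into UNIV K v)) \<and>
             (\<forall>v. act (uq_Z q a) v
                    = scale a (\<A> v) - scale (a^2) (inv_into UNIV B v)) \<and>
             (\<forall>v. act (uq_yinv q) v
                    = scale (1 / (inverse a - a))
                        (scale (inverse a) (inv_into UNIV K v) - scale a (inv_into UNIV B v))))"
proof -
  obtain Basis where "finite_dimensional_vector_space scale Basis"
    using tdp by (auto simp: tridiagonal_pair_def)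
  then interpret vector_space scale
    by (simp add: finite_dimensional_vector_space_def)
  define \<kappa> where "\<kappa> i = q powi (int d - 2 * int i)" for i
  define s where "s = inverse (q\<^sup>2)"
  have inv_\<kappa>: "q powi (2 * int i - int d) = inverse (\<kappa> i)" for i
    unfolding \<kappa>_def by (simp flip: power_int_minus)
  have \<kappa>_Suc: "\<kappa> (Suc i) = s * \<kappa> i" for i
  proof -
    have "\<kappa> (Suc i) = q powi ((int d - 2 * int i) + (- 2))"
      by (simp add: \<kappa>_def algebra_simps)
    also have "\<dots> = \<kappa> i * s"
      using q by (subst power_int_add) (simp_all add: \<kappa>_def s_def power_int_minus)
    finally show ?thesis
      by simp
  qed
  \<comment> \<open>This symmetry exchanges a with its inverse in the eigenvalues when the
    eigenspaces are reversed.\<close>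
  have \<kappa>_rev: "\<kappa> (d - i) = inverse (\<kappa> i)" if "i \<le> d" for i
    using that unfolding \<kappa>_def by (simp add: of_nat_diff algebra_simps flip: power_int_minus)
  have q2: "q\<^sup>2 \<noteq> 1"
    using q(2) by (metis power_mult power_one mult_2 numeral_Bit0)
  \<comment> \<open>Equality would give \<theta>_0 = \<theta>_d, although d is positive.\<close>
  have a_neq: "a \<noteq> inverse a"
  proof
    assume "a = inverse a"
    hence "\<theta> 0 = \<theta> d"
      using Racah by (simp add: add.commute)
    thus False
      using tridiagonal_ordering_inj[OF V \<theta>, of 0 d] d by simp
  qed
  interpret K: Vector_Spaces.linear scale scale K by (rule K)
  interpret B: Vector_Spaces.linear scale scale B by (rule B)
  interpret S: split_operator_pair scale \<A> \<A>s d V Vs \<theta> \<theta>s s a "inverse a" b "inverse b" \<kappa> K B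
  proof unfold_locales
    show "tridiagonal_ordering scale \<A> \<A>s d (\<lambda>i. V (d - i))"
      by (rule tridiagonal_ordering_rev[OF V])
    show "\<theta> (d - i) = inverse a * \<kappa> i + a * inverse (\<kappa> i)" if "i \<le> d" for i
      using Racah \<kappa>_rev[OF that] by (simp add: inv_\<kappa> flip: \<kappa>_def)
    show "B v = scale (\<kappa> i) v" if "i \<le> d" "v \<in> split_U scale d (\<lambda>i. V (d - i)) Vs i" for i v
      using B(2) that by (simp add: \<kappa>_def split_U_down_eq)
    show "\<kappa> i \<noteq> 0" for i
      using q by (simp add: \<kappa>_def)
  qed (use q K B \<kappa>_Suc Racah Racah_s \<theta> \<theta>s V Vs tdp ab a_neq in
      \<open>simp_all add: s_def inv_\<kappa> flip: \<kappa>_def\<close>)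
  let ?x = "inv_into UNIV K" and ?X = "inv_into UNIV B"
  \<comment> \<open>The generator y must act as well, because the relators are those of the full
    algebra; bijectivity of \<open>S.Y\<close> supplies its action.\<close>
  define \<rho> where "\<rho> g = (case g of Gen_x \<Rightarrow> ?x | Gen_y \<Rightarrow> inv_into UNIV S.Y | Gen_yinv \<Rightarrow> S.Y | Gen_z \<Rightarrow> S.z)" for g
  have lin: "Vector_Spaces.linear scale scale (\<rho> g)" for g
    using S.K.x linear_inv_into[OF S.Y S.bij_Y] S.Y S.z
    by (cases g) (simp_all add: \<rho>_def S.K.x_def)
  have rel: "free_act scale \<rho> p v = 0" if "p \<in> uq_relators q" for p v
  proof -
    have inv_Y: "S.Y (inv_into UNIV S.Y u) = u" "inv_into UNIV S.Y (S.Y u) = u" for u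
      using S.bij_Y by (simp_all add: surj_f_inv_f bij_is_surj bij_is_inj)
    have weyl: "free_act scale \<rho> (q_weyl_relator q Gen_x Gen_y) v = 0"
      "free_act scale \<rho> (q_weyl_relator q Gen_y Gen_z) v = 0"
      "free_act scale \<rho> (q_weyl_relator q Gen_z Gen_x) v = 0"
      using S.x_inv_Y S.inv_Y_z S.z_x
      by (auto intro!: free_act_weyl lin q q2 simp: \<rho>_def S.K.x_def s_def)
    show ?thesis
      using that weyl unfolding uq_relators_def
      by (auto simp: free_act_diff free_act_mult[OF lin] free_act_gen free_act_one inv_Y \<rho>_def)
  qed
  have module_lin_comb: "act (uq_X q a) v = scale (inverse (a\<^sup>2)) (act (uq_x q) v) + scale (1 - inverse (a\<^sup>2)) (act (uq_yinv q) v)"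
    "act (uq_Z q a) v = scale (a\<^sup>2) (act (uq_z q) v) + scale (1 - a\<^sup>2) (act (uq_yinv q) v)"
    "act (uq_A q a) v = scale (inverse a) (act (uq_x q) v) + scale a (act (uq_z q) v)"
    if "algebra_module_on scale (uq_vee q) (uq_scalar q) act" for act v
    unfolding uq_X_def uq_Z_def uq_A_def
    by (simp_all add: algebra_module_on_lin_comb[OF that] uq_vee_gen)
  have X_eq: "scale (inverse (a\<^sup>2)) (?x v) + scale (1 - inverse (a\<^sup>2)) (S.Y v) = ?X v" for v
  proof -
    have "1 - inverse (a\<^sup>2) = - inverse a * (inverse a - a)"
      using ab by (simp add: field_simps power2_eq_square)
    hence "scale (1 - inverse (a\<^sup>2)) (S.Y v) = scale (- inverse a) (scale (inverse a - a) (S.Y v))"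
      by simp
    thus ?thesis
      using ab unfolding S.scale_Y S.K.x_def S.B.x_def
      by (simp add: scale_right_diff_distrib power2_eq_square)
  qed
  show ?thesis
  proof (intro conjI allI impI)
    obtain act where act: "algebra_module_on scale (uq_vee q) (uq_scalar q) act"
      and gen: "\<And>g. act (uq_class q (free_gen g)) = \<rho> g"
      using ex_uq_vee_module[OF lin rel] by blast
    have "act (uq_x q) = ?x" "act (uq_yinv q) = S.Y" "act (uq_z q) = S.z"
      by (simp_all add: uq_x_def uq_yinv_def uq_z_def gen \<rho>_def)
    moreover from this have "act (uq_X q a) = ?X"
      by (auto simp: module_lin_comb[OF act] X_eq)
    moreover from calculation have "act (uq_A q a) = \<A>"
      using ab by (auto simp: module_lin_comb[OF act] S.z_def S.K.x_def scale_right_diff_distrib power2_eq_square)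
    ultimately show "\<exists>act. algebra_module_on scale (uq_vee q) (uq_scalar q) act \<and>
        act (uq_x q) = ?x \<and> act (uq_X q a) = ?X \<and> act (uq_A q a) = \<A>"
      using act by blast
  next
    fix act v
    assume "algebra_module_on scale (uq_vee q) (uq_scalar q) act \<and>
        act (uq_x q) = ?x \<and> act (uq_X q a) = ?X \<and> act (uq_A q a) = \<A>"
    hence act: "algebra_module_on scale (uq_vee q) (uq_scalar q) act"
      and acts: "act (uq_x q) = ?x" "act (uq_X q a) = ?X" "act (uq_A q a) = \<A>"
      by auto
    \<comment> \<open>For any such module, the actions of A and x determine that of z.\<close>
    have A_eq: "\<A> v = scale (inverse a) (?x v) + scale a (act (uq_z q) v)"
      using module_lin_comb(3)[OF act] by (simp add: acts)
    show z: "act (uq_z q) v = scale (inverse a) (\<A> v) - scale (inverse (a^2)) (?x v)"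
      unfolding A_eq using ab by (simp add: scale_right_distrib power2_eq_square)
    have "?X v = scale (inverse (a\<^sup>2)) (?x v) + scale (1 - inverse (a\<^sup>2)) (act (uq_yinv q) v)"
      using module_lin_comb(1)[OF act] by (simp add: acts)
    \<comment> \<open>Both y^-1 and \<open>S.Y\<close> satisfy the equation expressing X through x,
      and their common coefficient is nonzero.\<close>
    hence "scale (1 - inverse (a\<^sup>2)) (act (uq_yinv q) v) = scale (1 - inverse (a\<^sup>2)) (S.Y v)"
      using X_eq[of v] by (metis add_left_cancel)
    moreover have "1 - inverse (a\<^sup>2) \<noteq> 0"
      using ab a_neq by (simp add: field_simps power2_eq_square)
    ultimately have yinv: "act (uq_yinv q) v = S.Y v"
      by simp
    thus "act (uq_yinv q) v
        = scale (1 / (inverse a - a)) (scale (inverse a) (?x v) - scale a (?X v))"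
      by (simp add: S.Y_def S.K.x_def S.B.x_def)
    \<comment> \<open>This factor clears the denominator of \<open>S.Y\<close>; the terms in x of
      a^2 z and (1 - a^2) y^-1 then cancel in Z.\<close>
    have "1 - a\<^sup>2 = a * (inverse a - a)"
      using ab by (simp add: field_simps power2_eq_square)
    hence "scale (1 - a\<^sup>2) (S.Y v) = scale a (scale (inverse a - a) (S.Y v))"
      by simp
    moreover have "a * a * inverse a = a" "a * a * (inverse a * inverse a) = 1"
      using ab by (simp_all add: field_simps)
    ultimately show "act (uq_Z q a) v = scale a (\<A> v) - scale (a^2) (?X v)"
      using ab unfolding module_lin_comb(2)[OF act] z yinv S.scale_Y
      by (simp add: S.K.x_def S.B.x_def scale_right_diff_distrib power2_eq_square)
  qed
qed

end
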